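(* Let $\Omega\subset\mathbb R^d$ be an open neighborhood of the origin, and let $\eta$ be a translation-invariant point process on $\mathbb R^d$ of intensity $\rho>0$, supported on uniformly separated configurations. If $$\sigma_\eta(\Omega)=0,$$ then $$\rho\ge\mathcal D(\Omega).$$ In particular, if $C\subset\Omega$ is symmetric and convex, then $\rho\ge2^{-d}\lambda_d(C)$.
   Context: $\lambda_d$ is Lebesgue measure on $\mathbb R^d$. For an open neighborhood $\Omega$ of the origin, $\mathcal D(\Omega)=\sup\{\lambda_d(K):K\subset\mathbb R^d\text{ compact},\ K-K\subset\Omega\}$. $\mathcal N_s(\mathbb R^d)$ is the space of counting measures $\delta_P=\sum_{p\in P}\delta_p$ of locally finite sets $P\subset\mathbb R^d$, with the Borel structure of the vague topology and translation action $t.\delta_P=\delta_{P-t}$. A point process is a Borel probability measure $\eta$ on $\mathcal N_s(\mathbb R^d)$, translation-invariant if invariant under this action. Its intensity $\rho$ is defined by $\int\omega(f)\,d\eta(\omega)=\rho\int f\,d\lambda_d$ for $f\in C_c(\mathbb R^d)$. "Supported on uniformly separated configurations" means that there is $r>0$ such that $\eta$-almost every configuration $P$ is $r$-separated, i.e. distinct points of $P$ are at distance at least $r$ (hence $\eta$ has local second moments). The Bartlett spectrum $\sigma_\eta$ is the unique positive Radon measure on $\mathbb R^d$ with $\operatorname{Var}_\eta(N_f)=\int|\widehat f|^2\,d\sigma_\eta$ for all $f\in\mathcal S(\mathbb R^d)$, where $N_f(\omega)=\omega(f)$ and $\widehat f(\xi)=\int f(x)e^{-2\pi i\langle x,\xi\rangle}\,d\lambda_d(x)$.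 *)

theory Defs
  imports "HOL-Probability.Probability"
begin

definition locally_finite_set :: "'a::euclidean_space set \<Rightarrow> bool" where
  "locally_finite_set P \<longleftrightarrow> (\<forall>K. compact K \<longrightarrow> finite (P \<inter> K))"

text \<open>The Borel measure \<open>\<delta>\<^sub>P = \<Sum>\<^bsub>p\<in>P\<^esub> \<delta>\<^sub>p\<close>: the push-forward under inclusion of counting measure on \<open>P\<close>.
  The number \<open>\<omega>(f)\<close> is then the library integral \<open>LINT x|\<omega>. f x\<close>.\<close>

definition counting_measure :: "'a::euclidean_space set \<Rightarrow> 'a measure" where
  "counting_measure P = distr (count_space P) borel (\<lambda>p. p)"

definition configurations :: "'a::euclidean_space measure set" where
  "configurations = counting_measure ` {P. locally_finite_set P}"

definition compactly_supported_continuous :: "('a::euclidean_space \<Rightarrow> real) set" where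
  "compactly_supported_continuous =
     {f. continuous_on UNIV f \<and> compact (closure {x. f x \<noteq> 0})}"

definition vague_topology :: "'a::euclidean_space measure topology" where
  "vague_topology = topology_generated_by
     {{\<omega> \<in> configurations. (LINT x|\<omega>. f x) \<in> U} | f U.
        f \<in> compactly_supported_continuous \<and> open U}"

definition vague_borel :: "'a::euclidean_space measure measure" where
  "vague_borel = sigma configurations {U. openin vague_topology U}"

definition point_process :: "'a::euclidean_space measure measure \<Rightarrow> bool" where
  "point_process \<eta> \<longleftrightarrow> prob_space \<eta> \<and> sets \<eta> = sets vague_borel"

text \<open>On configurations this is \<open>t.\<delta>\<^sub>P = \<delta>\<^bsub>P - t\<^esub>\<close>.\<close>

definition translate :: "'a::euclidean_space \<Rightarrow> 'a measure \<Rightarrow> 'a measure" where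
  "translate t \<omega> = distr \<omega> borel (\<lambda>x. x - t)"

definition translation_invariant :: "'a::euclidean_space measure measure \<Rightarrow> bool" where
  "translation_invariant \<eta> \<longleftrightarrow> (\<forall>t. distr \<eta> vague_borel (translate t) = \<eta>)"

text \<open>Integrability is demanded explicitly because the library integral of a non-integrable
  function is \<open>0\<close>.\<close>

definition has_intensity :: "'a::euclidean_space measure measure \<Rightarrow> real \<Rightarrow> bool" where
  "has_intensity \<eta> \<rho> \<longleftrightarrow>
     (\<forall>f \<in> compactly_supported_continuous.
        integrable \<eta> (\<lambda>\<omega>. LINT x|\<omega>. f x) \<and>
        (LINT \<omega>|\<eta>. (LINT x|\<omega>. f x)) = \<rho> * (LINT x|lborel. f x))"

definition separated :: "real \<Rightarrow> 'a::euclidean_space set \<Rightarrow> bool" where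
  "separated r P \<longleftrightarrow> (\<forall>p\<in>P. \<forall>q\<in>P. p \<noteq> q \<longrightarrow> r \<le> dist p q)"

definition uniformly_separated :: "'a::euclidean_space measure measure \<Rightarrow> bool" where
  "uniformly_separated \<eta> \<longleftrightarrow>
     (\<exists>r>0. AE \<omega> in \<eta>. \<exists>P. locally_finite_set P \<and> \<omega> = counting_measure P \<and> separated r P)"

primrec iterated_derivative ::
    "'a::euclidean_space list \<Rightarrow> ('a \<Rightarrow> complex) \<Rightarrow> 'a \<Rightarrow> complex" where
  "iterated_derivative [] f = f"
| "iterated_derivative (b # bs) f =
     (\<lambda>x. frechet_derivative (iterated_derivative bs f) (at x) b)"

text \<open>Lists of basis vectors play the role of multi-indices. All iterated partial derivatives being
  differentiable everywhere amounts to smoothness.\<close>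

definition schwartz :: "('a::euclidean_space \<Rightarrow> complex) set" where
  "schwartz = {f. \<forall>bs. set bs \<subseteq> Basis \<longrightarrow>
     iterated_derivative bs f differentiable_on UNIV \<and>
     (\<forall>k. bounded (range (\<lambda>x. norm x ^ k *\<^sub>R iterated_derivative bs f x)))}"

definition fourier_transform :: "('a::euclidean_space \<Rightarrow> complex) \<Rightarrow> 'a \<Rightarrow> complex" where
  "fourier_transform f \<xi> =
     (LINT x|lborel. f x * exp (- 2 * complex_of_real pi * \<i> * complex_of_real (x \<bullet> \<xi>)))"

definition linear_statistic :: "('a::euclidean_space \<Rightarrow> complex) \<Rightarrow> 'a measure \<Rightarrow> complex" where
  "linear_statistic f \<omega> = (LINT x|\<omega>. f x)"

definition complex_variance :: "'b measure \<Rightarrow> ('b \<Rightarrow> complex) \<Rightarrow> ennreal" where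
  "complex_variance M X = (\<integral>\<^sup>+\<omega>. ennreal ((cmod (X \<omega> - (LINT \<omega>'|M. X \<omega>')))\<^sup>2) \<partial>M)"

text \<open>A Borel measure on a Euclidean space is Radon iff it is finite on compact sets. Both sides of
  the variance identity are values in \<open>[0, \<infinity>]\<close>, so no integrability convention interferes. The
  Bartlett spectrum is unique, so it is given by its defining property.\<close>

definition is_bartlett_spectrum ::
    "'a::euclidean_space measure measure \<Rightarrow> 'a measure \<Rightarrow> bool" where
  "is_bartlett_spectrum \<eta> \<sigma> \<longleftrightarrow>
     sets \<sigma> = sets borel \<and>
     (\<forall>K. compact K \<longrightarrow> emeasure \<sigma> K < \<infinity>) \<and>
     (\<forall>f \<in> schwartz. complex_variance \<eta> (linear_statistic f) =
        (\<integral>\<^sup>+\<xi>. ennreal ((cmod (fourier_transform f \<xi>))\<^sup>2) \<partial>\<sigma>))"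

text \<open>Here \<open>K - K\<close> is the Minkowski difference, not set difference. The supremum may be infinite.\<close>

definition packing_bound :: "'a::euclidean_space set \<Rightarrow> ennreal" where
  "packing_bound \<Omega> =
     (SUP K \<in> {K. compact K \<and> {x - y | x y. x \<in> K \<and> y \<in> K} \<subseteq> \<Omega>}. emeasure lebesgue K)"

end

theory Submission
  imports Defs "HOL-Complex_Analysis.Complex_Analysis"
begin

text \<open>Let \<open>K\<close> be compact with \<open>K - K \<subseteq> \<Omega>\<close>. If \<open>f \<ge> 0\<close> is a Schwartz function whose Fourier transform vanishes
off \<open>\<Omega>\<close>, then \<open>\<integral>|f^|\<^sup>2 d\<sigma> = 0\<close>, so the linear statistic \<open>N\<^sub>f\<close> has variance zero and equals its mean
\<open>\<rho> \<integral>f\<close> almost surely. Since \<open>\<rho> > 0\<close>, the configuration has a point \<open>p\<close> within any given distance of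
the origin with positive probability, and then \<open>f(p) \<le> N\<^sub>f = \<rho> \<integral>f\<close> because \<open>f \<ge> 0\<close>. Letting \<open>p\<close> tend
to the origin gives \<open>f(0) \<le> \<rho> \<integral>f\<close>; this is \<open>value_at_origin_le_intensity_times_integral\<close>. (In the
language of frames: the exponentials with frequencies in the configuration form a tight frame of
\<open>L\<^sup>2(K)\<close> with bound \<open>\<rho>\<close>, and each of them has squared norm \<open>\<lambda>(K)\<close>, whence \<open>\<lambda>(K) \<le> \<rho>\<close>.)

It remains to find \<open>f\<close> with \<open>f(0) / \<integral>f\<close> close to \<open>\<lambda>(K)\<close>. The ideal choice is \<open>|F|\<^sup>2\<close>, where \<open>F\<close> is the
inverse Fourier transform of the indicator of \<open>K\<close>, but it is not a Schwartz function. Instead of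
smoothing the indicator in \<open>d\<close> dimensions, cover \<open>K\<close> by cubes of a grid of mesh \<open>h\<close> and let \<open>J\<close> be the
set of their lower corners. With a single function \<open>v\<close> on the line put
\<open>f(x) = |\<Sum>\<^bsub>c\<in>J\<^esub> exp(2 \<pi> i \<langle>c, x\<rangle>)|\<^sup>2 \<Prod>\<^sub>b v(h x\<^sub>b)\<close>.
If the transform of \<open>v\<close> vanishes outside \<open>(-1, 1)\<close>, then the transform of \<open>f\<close> lives on cubes of
half-side \<open>h\<close> around the points \<open>c - c'\<close>, which lie in \<open>\<Omega>\<close> for small \<open>h\<close>; and since distinct grid
points differ by at least \<open>h\<close> in some coordinate, only the diagonal terms contribute to \<open>\<integral>f\<close>. So
\<open>f(0) = |J|\<^sup>2\<close> and \<open>\<integral>f = |J| (V/h)\<^sup>d\<close> with \<open>v(0) = 1\<close>, \<open>V = \<integral>v\<close>, and therefore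
\<open>\<lambda>(K) \<le> |J| h\<^sup>d \<le> \<rho> V\<^sup>d\<close>. This is \<open>grid_test_function\<close> and \<open>emeasure_compact_le_intensity\<close>.

What is needed on the line (\<open>bandlimited_test_function\<close>) is a nonnegative Schwartz function \<open>v\<close> with
\<open>v(0) = 1\<close>, transform vanishing outside \<open>(-1, 1)\<close> and \<open>V\<close> arbitrarily close to \<open>1\<close>. The square of an
infinite product of functions \<open>sinc(\<pi> b\<^sub>n x)\<close> with \<open>\<Sum>b\<^sub>n = 1\<close> and \<open>b\<^sub>0\<close> close to \<open>1\<close> has all these
properties: each factor adds decay \<open>1/|x|\<close>, the leading factor controls the integral, and each
multiplication by a sinc function averages the transform over translates, which widens its support
by a controlled amount. The Schwartz estimates for derivatives come from Cauchy's inequality, since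
the product is entire and decreases rapidly in every horizontal strip.

For a symmetric convex set \<open>C\<close> one has \<open>C/2 - C/2 = C\<close>, so the bound applies to the compact subsets of
\<open>C/2\<close>.\<close>

section \<open>The Fourier transform of the squared sinc function\<close>

lemma fourier_transform_real:
  fixes f :: "real \<Rightarrow> complex"
  shows "fourier_transform f s = (LINT x|lborel. f x * cis (- 2 * pi * x * s))"
  unfolding fourier_transform_def by (simp add: cis_conv_exp algebra_simps)

lemma borel_measurable_cis [measurable]: "cis \<in> borel_measurable borel"
  by (intro borel_measurable_continuous_onI continuous_intros continuous_on_id)

lemma integrable_times_cis:
  fixes f :: "'a \<Rightarrow> complex"
  assumes "integrable M f" and [measurable]: "g \<in> borel_measurable M"
  shows "integrable M (\<lambda>x. f x * cis (g x))"
proof (rule Bochner_Integration.integrable_bound[OF assms(1)])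
  have [measurable]: "f \<in> borel_measurable M" using assms(1) by auto
  show "(\<lambda>x. f x * cis (g x)) \<in> borel_measurable M" by measurable
qed (simp add: norm_mult)

lemma fourier_transform_scale:
  fixes f :: "real \<Rightarrow> complex"
  assumes "a > 0"
  shows "fourier_transform (\<lambda>x. f (a * x)) s = fourier_transform f (s / a) / of_real a"
  unfolding fourier_transform_real
  using assms lborel_integral_real_affine[of a "\<lambda>x. f x * cis (- 2 * pi * x * (s / a))" 0]
  by (simp add: scaleR_conv_of_real field_simps)

lemma fourier_transform_even:
  fixes f :: "real \<Rightarrow> complex"
  assumes "\<And>x. f (- x) = f x"
  shows "fourier_transform f (- s) = fourier_transform f s"
  unfolding fourier_transform_real
  using lborel_integral_real_affine[of "-1" "\<lambda>x. f x * cis (- 2 * pi * x * (- s))" 0]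
  by (simp add: assms)

text \<open>Integration by parts turns \<open>\<integral>sinc\<^sup>2\<close> into the sine integral, whose limit at infinity is known; writing
the boundary term as \<open>sin x * sinc x\<close> keeps the antiderivative smooth at the origin.\<close>

lemma has_real_derivative_sinc_square_antiderivative:
  "((\<lambda>x. Si (2 * x) - sin x * sinc x) has_real_derivative (sinc x)\<^sup>2) (at x)"
proof (cases "x = 0")
  case True
  have "((\<lambda>x. sin x * sinc x) has_real_derivative (sinc 0)\<^sup>2) (at 0)"
    unfolding CARAT_DERIV
  proof (intro exI conjI allI)
    show "isCont (\<lambda>x. (sinc x)\<^sup>2) 0" using isCont_sinc[of 0] by (intro continuous_intros)
  qed (auto simp: power2_eq_square)
  moreover have "((\<lambda>x. Si (2 * x)) has_real_derivative sinc (2 * 0) * 2) (at 0)"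
    by (rule DERIV_chain2[OF DERIV_Si]) (auto intro!: derivative_eq_intros)
  ultimately have "((\<lambda>x. Si (2 * x) - sin x * sinc x) has_real_derivative
      sinc (2 * 0) * 2 - (sinc 0)\<^sup>2) (at 0)" by (rule DERIV_diff[rotated])
  then show ?thesis using True by simp
next
  case False
  have "((\<lambda>x. Si (2 * x)) has_real_derivative sinc (2 * x) * 2) (at x)"
    by (rule DERIV_chain2[OF DERIV_Si]) (auto intro!: derivative_eq_intros)
  moreover have "((\<lambda>x. sin x * (sin x / x)) has_real_derivative
      2 * sin x * cos x / x - (sin x)\<^sup>2 / x\<^sup>2) (at x)"
    using False by (auto intro!: derivative_eq_intros simp: field_simps power2_eq_square)
  then have "((\<lambda>x. sin x * sinc x) has_real_derivative
      2 * sin x * cos x / x - (sin x)\<^sup>2 / x\<^sup>2) (at x)"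
    by (rule has_field_derivative_transform_within_open[where S = "- {0}"]) (use False in auto)
  ultimately have "((\<lambda>x. Si (2 * x) - sin x * sinc x) has_real_derivative
      sinc (2 * x) * 2 - (2 * sin x * cos x / x - (sin x)\<^sup>2 / x\<^sup>2)) (at x)"
    by (rule DERIV_diff)
  then show ?thesis using False by (simp add: sin_double power_divide)
qed

lemma has_bochner_integral_sinc_square:
  "has_bochner_integral lborel (\<lambda>x. (sinc x)\<^sup>2) pi"
proof -
  have "((\<lambda>x. Si (2 * x)) \<longlongrightarrow> pi / 2) at_top"
    by (rule filterlim_compose[OF Si_at_top]) real_asymp
  moreover have "((\<lambda>x. sin x * sinc x) \<longlongrightarrow> 0) at_top"
  proof (rule Lim_null_comparison)
    show "\<forall>\<^sub>F x in at_top. norm (sin x * sinc x) \<le> 1 / x"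
      using eventually_gt_at_top[of 0]
    proof eventually_elim
      case (elim x)
      have "\<bar>sin x\<bar> * \<bar>sin x\<bar> \<le> 1 * 1" by (intro mult_mono) auto
      then show ?case using elim by (simp add: abs_mult field_simps)
    qed
    show "((\<lambda>x::real. 1 / x) \<longlongrightarrow> 0) at_top" by real_asymp
  qed
  ultimately have lim: "((\<lambda>x. Si (2 * x) - sin x * sinc x) \<longlongrightarrow> pi / 2) at_top"
    using tendsto_diff by fastforce
  have m: "(\<lambda>x. (sinc x)\<^sup>2) \<in> borel_measurable borel" by measurable
  have half: "(\<integral>\<^sup>+x. ennreal ((sinc x)\<^sup>2) * indicator {0..} x \<partial>lborel) = ennreal (pi / 2)"
    using nn_integral_FTC_atLeast[OF m has_real_derivative_sinc_square_antiderivative _ lim, of 0]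
    by (simp add: Si_alt_def interval_integral_endpoints_same flip: zero_ereal_def)
  have [measurable]: "sinc \<in> borel_measurable borel" by measurable
  have "(\<integral>\<^sup>+x. ennreal ((sinc x)\<^sup>2) * indicator {..0} x \<partial>lborel)
      = (\<integral>\<^sup>+x. ennreal ((sinc x)\<^sup>2) * indicator {0..} x \<partial>lborel)"
    by (subst nn_integral_real_affine[where c = "-1" and t = 0])
      (auto intro!: nn_integral_cong simp: indicator_def)
  then have "ennreal (pi / 2) + ennreal (pi / 2)
      = (\<integral>\<^sup>+x. ennreal ((sinc x)\<^sup>2) * indicator {..0} x + ennreal ((sinc x)\<^sup>2) * indicator {0..} x \<partial>lborel)"
    using half by (subst nn_integral_add) auto
  also have "\<dots> = (\<integral>\<^sup>+x. ennreal ((sinc x)\<^sup>2) \<partial>lborel)"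
  proof (rule nn_integral_cong_AE)
    show "AE x in lborel. ennreal ((sinc x)\<^sup>2) * indicator {..0} x + ennreal ((sinc x)\<^sup>2) * indicator {0..} x
        = ennreal ((sinc x)\<^sup>2)"
      using AE_lborel_singleton[of 0] by eventually_elim (auto simp: indicator_def)
  qed
  finally have "(\<integral>\<^sup>+x. ennreal ((sinc x)\<^sup>2) \<partial>lborel) = ennreal pi"
    by (simp add: ennreal_plus[symmetric] del: ennreal_plus)
  then show ?thesis by (intro has_bochner_integral_nn_integral) auto
qed

text \<open>The building block for transforms of \<open>sinc\<^sup>2\<close>: multiplying \<open>sinc\<^sup>2\<close> by a cosine gives a
second difference of such functions in \<open>c\<close>, and a second difference of \<open>\<bar>c\<bar>\<close> has compact support.\<close>

lemma has_bochner_integral_one_minus_cos: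
  "has_bochner_integral lborel (\<lambda>x. (1 - cos (c * x)) / x\<^sup>2) (pi * \<bar>c\<bar>)"
proof (cases "c = 0")
  case False
  have "has_bochner_integral lborel (\<lambda>x. (sinc (0 + c / 2 * x))\<^sup>2) (pi /\<^sub>R \<bar>c / 2\<bar>)"
    using False by (subst lborel_has_bochner_integral_real_affine_iff[symmetric])
      (auto intro: has_bochner_integral_sinc_square)
  then have "has_bochner_integral lborel (\<lambda>x. c\<^sup>2 / 2 * (sinc (0 + c / 2 * x))\<^sup>2) (c\<^sup>2 / 2 * (pi /\<^sub>R \<bar>c / 2\<bar>))"
    by (intro has_bochner_integral_mult_right) auto
  moreover have "c\<^sup>2 / 2 * (pi /\<^sub>R \<bar>c / 2\<bar>) = pi * \<bar>c\<bar>"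
    using False by (cases "c > 0") (auto simp: field_simps power2_eq_square)
  moreover have *: "AE x in lborel. x \<noteq> (0::real)" by (rule AE_lborel_singleton)
  have **: "(1 - cos (c * x)) / x\<^sup>2 = c\<^sup>2 / 2 * (sinc (0 + c / 2 * x))\<^sup>2" if "x \<noteq> 0" for x
    using that False cos_double_sin[of "c / 2 * x"] by (simp add: field_simps)
  have "AE x in lborel. (1 - cos (c * x)) / x\<^sup>2 = c\<^sup>2 / 2 * (sinc (0 + c / 2 * x))\<^sup>2"
    by (rule eventually_mono[OF *], rule **)
  ultimately show ?thesis
    by (subst has_bochner_integral_cong_AE[where g = "\<lambda>x. c\<^sup>2 / 2 * (sinc (0 + c / 2 * x))\<^sup>2"]) auto
qed auto

lemma integrable_sinc_square: "a > 0 \<Longrightarrow> integrable lborel (\<lambda>x. (sinc (a * x))\<^sup>2)"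
  using has_bochner_integral_sinc_square
  by (subst lborel_integrable_real_affine_iff[of a _ 0, simplified])
    (auto simp: has_bochner_integral_iff)

text \<open>The triangle function is half the second difference of the absolute value,
\<open>\<bar>s + 1\<bar> + \<bar>s - 1\<bar> - 2 \<bar>s\<bar> = 2 max 0 (1 - \<bar>s\<bar>)\<close>. The transform is real because the function is even, so
only the cosine part has to be integrated.\<close>

lemma fourier_transform_sinc_square:
  "fourier_transform (\<lambda>x. of_real ((sinc (pi * x))\<^sup>2)) s = of_real (max 0 (1 - \<bar>s\<bar>))"
proof -
  let ?f = "\<lambda>x. complex_of_real ((sinc (pi * x))\<^sup>2)"
  let ?h = "\<lambda>c x. (1 - cos (c * x)) / x\<^sup>2"
  have int: "integrable lborel ?f" by (intro integrable_of_real integrable_sinc_square) simp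
  have fint: "integrable lborel (\<lambda>x. ?f x * cis (- 2 * pi * x * t))" for t
    by (intro integrable_times_cis int) auto
  have refl: "fourier_transform ?f (- s) = fourier_transform ?f s"
    by (rule fourier_transform_even) simp
  have "2 * fourier_transform ?f s = fourier_transform ?f s + fourier_transform ?f (- s)"
    using refl by simp
  also have "\<dots> = (LINT x|lborel. ?f x * cis (- 2 * pi * x * s) + ?f x * cis (- 2 * pi * x * (- s)))"
    unfolding fourier_transform_real by (rule Bochner_Integration.integral_add[OF fint fint, symmetric])
  also have "\<dots> = (LINT x|lborel. complex_of_real (2 * (sinc (pi * x))\<^sup>2 * cos (2 * pi * s * x)))"
    by (intro Bochner_Integration.integral_cong) (auto simp: complex_eq_iff algebra_simps)
  also have "\<dots> = of_real (LINT x|lborel. 2 * (sinc (pi * x))\<^sup>2 * cos (2 * pi * s * x))"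
    by (rule integral_complex_of_real)
  also have "(LINT x|lborel. 2 * (sinc (pi * x))\<^sup>2 * cos (2 * pi * s * x))
     = (LINT x|lborel. (?h (2 * pi * (s + 1)) x + ?h (2 * pi * (s - 1)) x - 2 * ?h (2 * pi * s) x) / (2 * pi\<^sup>2))"
  proof (rule integral_cong_AE)
    have "2 * (sinc (pi * x))\<^sup>2 * cos (2 * pi * s * x)
        = (?h (2 * pi * (s + 1)) x + ?h (2 * pi * (s - 1)) x - 2 * ?h (2 * pi * s) x) / (2 * pi\<^sup>2)"
      if "x \<noteq> 0" for x
    proof -
      have "cos (2 * pi * (s + 1) * x) + cos (2 * pi * (s - 1) * x) = 2 * cos (2 * pi * s * x) * cos (2 * (pi * x))"
        by (simp add: distrib_left distrib_right left_diff_distrib right_diff_distrib cos_add cos_diff mult.assoc)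
      then have "(1 - cos (2 * pi * (s + 1) * x)) + (1 - cos (2 * pi * (s - 1) * x)) - 2 * (1 - cos (2 * pi * s * x))
        = 4 * cos (2 * pi * s * x) * (sin (pi * x))\<^sup>2"
        unfolding cos_double_sin by (simp add: algebra_simps)
      then show ?thesis using that
        by (simp add: power_divide power_mult_distrib field_simps flip: add_divide_distrib diff_divide_distrib)
    qed
    then show "AE x in lborel. 2 * (sinc (pi * x))\<^sup>2 * cos (2 * pi * s * x)
        = (?h (2 * pi * (s + 1)) x + ?h (2 * pi * (s - 1)) x - 2 * ?h (2 * pi * s) x) / (2 * pi\<^sup>2)"
      using AE_lborel_singleton[of 0] by (auto elim: eventually_mono)
  qed measurable
  also have "\<dots> = (pi * \<bar>2 * pi * (s + 1)\<bar> + pi * \<bar>2 * pi * (s - 1)\<bar> - 2 * (pi * \<bar>2 * pi * s\<bar>)) / (2 * pi\<^sup>2)"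
    by (intro has_bochner_integral_integral_eq has_bochner_integral_divide has_bochner_integral_add
        has_bochner_integral_diff has_bochner_integral_mult_right has_bochner_integral_one_minus_cos) 
  also have "\<dots> = \<bar>s + 1\<bar> + \<bar>s - 1\<bar> - 2 * \<bar>s\<bar>"
    unfolding abs_mult by (simp add: power2_eq_square add_divide_distrib diff_divide_distrib)
  also have "\<dots> = 2 * max 0 (1 - \<bar>s\<bar>)" by (simp add: max_def abs_if)
  finally show ?thesis by simp
qed

section \<open>Entire functions that decrease rapidly in horizontal strips\<close>

definition complex_sinc :: "complex \<Rightarrow> complex" where
  "complex_sinc z = (if z = 0 then 1 else sin z / z)"

lemma complex_sinc_of_real: "complex_sinc (of_real x) = of_real (sinc x)"
  by (simp add: complex_sinc_def sin_of_real)

lemma complex_sinc_holomorphic: "complex_sinc holomorphic_on UNIV"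
proof -
  have "deriv sin (0 :: complex) = 1"
    by (rule DERIV_imp_deriv) (auto intro!: derivative_eq_intros)
  then have "complex_sinc = (\<lambda>z. if z = 0 then deriv sin 0 else (sin z - sin 0) / (z - 0))"
    by (simp add: fun_eq_iff complex_sinc_def)
  moreover have "\<dots> holomorphic_on UNIV"
    by (intro pole_lemma holomorphic_intros) auto
  ultimately show ?thesis by simp
qed

lemma
  shows norm_sin_le_exp_Im: "cmod (sin z) \<le> exp \<bar>Im z\<bar>"
    and norm_cos_le_exp_Im: "cmod (cos z) \<le> exp \<bar>Im z\<bar>"
proof -
  have *: "cmod (exp (\<i> * z)) \<le> exp \<bar>Im z\<bar>" "cmod (exp (- (\<i> * z))) \<le> exp \<bar>Im z\<bar>"
    by (simp_all add: norm_exp_eq_Re)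
  have "cmod (exp (\<i> * z) - exp (- (\<i> * z))) \<le> exp \<bar>Im z\<bar> + exp \<bar>Im z\<bar>"
    by (rule order_trans[OF norm_triangle_ineq4 add_mono]) (fact *)+
  then show "cmod (sin z) \<le> exp \<bar>Im z\<bar>" by (simp add: sin_exp_eq norm_divide norm_mult)
  have "cmod (exp (\<i> * z) + exp (- (\<i> * z))) \<le> exp \<bar>Im z\<bar> + exp \<bar>Im z\<bar>"
    by (rule order_trans[OF norm_triangle_ineq add_mono]) (fact *)+
  then show "cmod (cos z) \<le> exp \<bar>Im z\<bar>" by (simp add: cos_exp_eq norm_divide)
qed

lemma norm_mult_complex_sinc_le: "cmod z * cmod (complex_sinc z) \<le> exp \<bar>Im z\<bar>"
  using norm_sin_le_exp_Im[of z] by (simp add: complex_sinc_def norm_divide)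

text \<open>The constant \<open>1\<close> in front of the exponential is essential, because the bound is multiplied over
infinitely many factors. It comes from the mean value inequality for the sine on the strip
\<open>\<bar>Im w\<bar> \<le> \<bar>Im z\<bar>\<close>.\<close>

lemma norm_complex_sinc_le: "cmod (complex_sinc z) \<le> exp \<bar>Im z\<bar>"
proof (cases "z = 0")
  case False
  have "cmod (sin z - sin 0) \<le> exp \<bar>Im z\<bar> * cmod (z - 0)"
  proof (rule field_differentiable_bound)
    show "convex {w. \<bar>Im w\<bar> \<le> \<bar>Im z\<bar>}"
    proof -
      have "{w. \<bar>Im w\<bar> \<le> \<bar>Im z\<bar>} = {w. Im w \<ge> - \<bar>Im z\<bar>} \<inter> {w. Im w \<le> \<bar>Im z\<bar>}" by auto
      then show ?thesis by (auto intro: convex_Int convex_halfspace_Im_ge convex_halfspace_Im_le)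
    qed
    show "(sin has_field_derivative cos w) (at w within {w. \<bar>Im w\<bar> \<le> \<bar>Im z\<bar>})" for w
      by (auto intro!: derivative_eq_intros)
    show "cmod (cos w) \<le> exp \<bar>Im z\<bar>" if "w \<in> {w. \<bar>Im w\<bar> \<le> \<bar>Im z\<bar>}" for w
      using norm_cos_le_exp_Im[of w] that by (auto intro: order_trans)
  qed auto
  then show ?thesis using False by (simp add: complex_sinc_def norm_divide field_simps)
qed (simp add: complex_sinc_def)

text \<open>A factor close to one near the origin: this makes infinite products of rescaled sinc functions
converge locally uniformly.\<close>

lemma norm_complex_sinc_minus_one_le: "cmod (complex_sinc z - 1) \<le> cmod z * exp (cmod z)"
proof (cases "z = 0")
  case False
  have cos: "cmod (cos w - 1) \<le> cmod z * exp (cmod z)" if "w \<in> cball 0 (cmod z)" for w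
  proof -
    have "cmod (cos w - cos 0) \<le> exp (cmod z) * cmod (w - 0)"
    proof (rule field_differentiable_bound)
      show "(cos has_field_derivative - sin u) (at u within cball 0 (cmod z))" for u :: complex
        by (auto intro!: derivative_eq_intros)
      show "cmod (- sin u) \<le> exp (cmod z)" if "u \<in> cball 0 (cmod z)" for u
        using norm_sin_le_exp_Im[of u] abs_Im_le_cmod[of u] that by (auto intro: order_trans)
    qed (use that in auto)
    also have "\<dots> \<le> exp (cmod z) * cmod z" using that by (intro mult_left_mono) auto
    finally show ?thesis by (simp add: mult.commute)
  qed
  have "cmod ((sin z - z) - (sin 0 - 0)) \<le> (cmod z * exp (cmod z)) * cmod (z - 0)"
    by (rule field_differentiable_bound[of "cball 0 (cmod z)" "\<lambda>z. sin z - z" "\<lambda>w. cos w - 1"])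
      (auto intro!: derivative_eq_intros cos)
  moreover have "complex_sinc z - 1 = (sin z - z) / z"
    using False by (simp add: complex_sinc_def diff_divide_distrib)
  ultimately show ?thesis
    using False by (simp only: norm_divide) (simp add: divide_le_eq mult_ac)
qed (simp add: complex_sinc_def)

text \<open>Bounds in whole strips, and not only on the real line, make the class stable under differentiation:
Cauchy's inequality on unit circles loses only one unit of the width of the strip. Restrictions of
such functions to the real line are Schwartz functions.\<close>

definition rapidly_decreasing_entire :: "(complex \<Rightarrow> complex) \<Rightarrow> bool" where
  "rapidly_decreasing_entire \<phi> \<longleftrightarrow> \<phi> holomorphic_on UNIV \<and>
     (\<forall>R k. \<exists>B. \<forall>z. \<bar>Im z\<bar> \<le> R \<longrightarrow> (1 + cmod z) ^ k * cmod (\<phi> z) \<le> B)"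

text \<open>For \<open>N \<ge> k\<close> the first \<open>k\<close> factors of the partial product are estimated by
\<open>exp(a\<^sub>n \<bar>Im z\<bar>) / (a\<^sub>n \<bar>z\<bar>)\<close> and the others by \<open>exp(a\<^sub>n \<bar>Im z\<bar>)\<close>. Since \<open>\<Sum>a\<^sub>n\<close> converges, the product is
bounded by a multiple of \<open>\<bar>z\<bar>\<^sup>-\<^sup>k\<close> in each strip, uniformly in \<open>N\<close>.\<close>

lemma sinc_product_entire:
  fixes a :: "nat \<Rightarrow> real"
  assumes pos: "\<And>n. a n > 0" and sum: "summable a"
  obtains p where "rapidly_decreasing_entire p"
    and "\<And>z. (\<lambda>N. \<Prod>n<N. complex_sinc (of_real (a n) * z)) \<longlonglongrightarrow> p z"
proof -
  define A where "A = suminf a"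
  define P where "P = (\<lambda>N z. \<Prod>n<N. complex_sinc (of_real (a n) * z))"
  define p where "p = (\<lambda>z. lim (\<lambda>N. P N z))"
  have hol: "(\<lambda>z. complex_sinc (of_real (a n) * z)) holomorphic_on S" for n S
    using holomorphic_on_compose[of "\<lambda>z. of_real (a n) * z" S complex_sinc]
      holomorphic_on_subset[OF complex_sinc_holomorphic]
    by (auto simp: o_def intro!: holomorphic_intros)
  have le_A: "(\<Sum>n<N. a n) \<le> A" for N
    unfolding A_def by (rule sum_le_suminf[OF sum]) (auto simp: less_imp_le pos)
  have a_le: "a n \<le> A" for n
    using le_A[of "Suc n"] sum_nonneg[of "{..<n}" a] pos by (simp add: less_imp_le)
  have unif: "uniform_limit (cball 0 R) P p sequentially" if "R > 0" for R
  proof -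
    have "uniformly_convergent_on (cball 0 R)
        (\<lambda>N z. \<Sum>n<N. cmod (complex_sinc (of_real (a n) * z) - 1))"
    proof (rule Weierstrass_m_test'_ev, intro always_eventually allI ballI)
      fix n :: nat and z :: complex assume "z \<in> cball 0 R"
      then have z: "a n * cmod z \<le> a n * R" "a n * cmod z \<le> A * R"
        using pos[of n] a_le[of n] that by (auto intro!: mult_left_mono mult_mono)
      have "cmod (complex_sinc (of_real (a n) * z) - 1) \<le> (a n * cmod z) * exp (a n * cmod z)"
        using norm_complex_sinc_minus_one_le[of "of_real (a n) * z"] pos[of n] by (simp add: norm_mult)
      also have "\<dots> \<le> (a n * R) * exp (A * R)"
        using z pos[of n] that by (intro mult_mono) auto
      finally show "norm (cmod (complex_sinc (of_real (a n) * z) - 1)) \<le> a n * R * exp (A * R)" by simp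
    qed (intro summable_mult2 sum)
    then have "uniformly_convergent_on (cball 0 R) P"
      unfolding P_def by (intro uniformly_convergent_on_prod' holomorphic_on_imp_continuous_on hol) auto
    then show ?thesis unfolding p_def uniformly_convergent_uniform_limit_iff .
  qed
  have lim: "(\<lambda>N. P N z) \<longlonglongrightarrow> p z" for z
    by (rule tendsto_uniform_limitI[OF unif[of "cmod z + 1"]]) (auto simp: add_nonneg_pos)
  have "p holomorphic_on UNIV"
  proof (rule holomorphic_uniform_sequence)
    show "P N holomorphic_on UNIV" for N unfolding P_def by (intro holomorphic_intros hol)
    fix z :: complex
    have "cball z 1 \<subseteq> cball 0 (cmod z + 1)"
      by (auto simp: dist_norm) (smt (verit) norm_triangle_sub norm_minus_commute)
    then show "\<exists>d>0. cball z d \<subseteq> UNIV \<and> uniform_limit (cball z d) P p sequentially"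
      using uniform_limit_on_subset[OF unif[of "cmod z + 1"]] by (intro exI[of _ 1]) (auto simp: add_nonneg_pos)
  qed auto
  moreover have "\<exists>B. \<forall>z. \<bar>Im z\<bar> \<le> R \<longrightarrow> (1 + cmod z) ^ k * cmod (p z) \<le> B" for R :: real and k
  proof -
    have bound: "cmod z ^ k * cmod (p z) \<le> (\<Prod>n<k. 1 / a n) * exp (A * R)" if z: "\<bar>Im z\<bar> \<le> R" for z :: complex and k
    proof (rule LIMSEQ_le_const2)
      show "(\<lambda>N. cmod z ^ k * cmod (P N z)) \<longlonglongrightarrow> cmod z ^ k * cmod (p z)"
        by (intro tendsto_intros lim)
      have "cmod z ^ k * cmod (P N z) \<le> (\<Prod>n<k. 1 / a n) * exp (A * R)" if "N \<ge> k" for N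
      proof -
        have restrict: "(\<Prod>n<N. if n < k then f n else 1) = (\<Prod>n<k. f n)" for f :: "nat \<Rightarrow> real"
          using that by (subst prod.inter_filter[symmetric]) (auto intro!: prod.cong)
        have "cmod z ^ k * cmod (P N z)
          = (\<Prod>n<N. (if n < k then cmod z else 1) * cmod (complex_sinc (of_real (a n) * z)))"
          unfolding prod.distrib restrict by (simp add: P_def flip: prod_norm)
        also have "\<dots> \<le> (\<Prod>n<N. (if n < k then 1 / a n else 1) * exp (a n * R))"
        proof (rule prod_mono, intro conjI)
          fix n
          have e: "exp (a n * \<bar>Im z\<bar>) \<le> exp (a n * R)" using z pos[of n] by simp
          have "a n * cmod z * cmod (complex_sinc (of_real (a n) * z)) \<le> exp (a n * R)"
            using norm_mult_complex_sinc_le[of "of_real (a n) * z"] pos[of n]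
            by (intro order_trans[OF _ e]) (simp add: norm_mult abs_mult)
          moreover have "cmod (complex_sinc (of_real (a n) * z)) \<le> exp (a n * R)"
            using norm_complex_sinc_le[of "of_real (a n) * z"] pos[of n]
            by (intro order_trans[OF _ e]) (simp add: abs_mult)
          ultimately show "(if n < k then cmod z else 1) * cmod (complex_sinc (of_real (a n) * z))
            \<le> (if n < k then 1 / a n else 1) * exp (a n * R)"
            using pos[of n] by (simp add: field_simps)
        qed auto
        also have "\<dots> = (\<Prod>n<k. 1 / a n) * exp ((\<Sum>n<N. a n) * R)"
          unfolding prod.distrib restrict by (simp add: exp_sum sum_distrib_right)
        also have "\<dots> \<le> (\<Prod>n<k. 1 / a n) * exp (A * R)"
          using le_A[of N] z pos by (intro mult_left_mono prod_nonneg) (auto intro: mult_right_mono simp: less_imp_le)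
        finally show ?thesis .
      qed
      then show "\<exists>N. \<forall>n\<ge>N. cmod z ^ k * cmod (P n z) \<le> (\<Prod>n<k. 1 / a n) * exp (A * R)" by blast
    qed
    have power: "(1 + x) ^ k \<le> 2 ^ k * (1 + x ^ k)" if "x \<ge> 0" for x :: real
    proof (cases "x \<le> 1")
      case True
      then have "(1 + x) ^ k \<le> 2 ^ k" using that by (intro power_mono) auto
      also have "\<dots> \<le> 2 ^ k * (1 + x ^ k)" using that by simp
      finally show ?thesis .
    next
      case False
      then have "(1 + x) ^ k \<le> (2 * x) ^ k" by (intro power_mono) auto
      then show ?thesis using that by (simp add: power_mult_distrib algebra_simps add_increasing)
    qed
    have "(1 + cmod z) ^ k * cmod (p z) \<le> 2 ^ k * (exp (A * R) + (\<Prod>n<k. 1 / a n) * exp (A * R))"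
      if "\<bar>Im z\<bar> \<le> R" for z :: complex
    proof -
      have "(1 + cmod z) ^ k * cmod (p z) \<le> 2 ^ k * (1 + cmod z ^ k) * cmod (p z)"
        by (intro mult_right_mono power) auto
      also have "\<dots> = 2 ^ k * (cmod z ^ 0 * cmod (p z) + cmod z ^ k * cmod (p z))"
        by (simp add: algebra_simps)
      also have "\<dots> \<le> 2 ^ k * (exp (A * R) + (\<Prod>n<k. 1 / a n) * exp (A * R))"
        using bound[OF that, of 0] bound[OF that, of k] by (intro mult_left_mono add_mono) auto
      finally show ?thesis .
    qed
    then show ?thesis by blast
  qed
  ultimately have "rapidly_decreasing_entire p" unfolding rapidly_decreasing_entire_def by blast
  from that[OF this lim[unfolded P_def]] show thesis .
qed

section \<open>Band-limited test functions on the line\<close>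

lemma sinc_eq_integral_cis:
  "(LINT u|lborel. indicator {-1/2..1/2} u *\<^sub>R cis (2 * x * u)) = complex_of_real (sinc x)"
proof (cases "x = 0")
  case False
  have "(LINT u|lborel. indicator {-1/2..1/2} u *\<^sub>R cis (2 * x * u))
      = cis (2 * x * (1/2)) / (2 * \<i> * of_real x) - cis (2 * x * (-1/2)) / (2 * \<i> * of_real x)"
  proof (rule integral_FTC_Icc)
    show "((\<lambda>u. cis (2 * x * u) / (2 * \<i> * of_real x)) has_vector_derivative cis (2 * x * u))
        (at u within {-1/2..1/2})" for u
      using False unfolding cis_conv_exp
      by (auto intro!: derivative_eq_intros has_vector_derivative_real_field simp: field_simps scaleR_conv_of_real)
    show "continuous_on {-1/2..1/2} (\<lambda>u. cis (2 * x * u))"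
      by (intro continuous_intros)
  qed auto
  also have "\<dots> = of_real (sin x / x)"
    using False by (simp add: complex_eq_iff Re_divide Im_divide power2_eq_square)
  finally show ?thesis using False by simp
qed auto

text \<open>The sinc function is an average of characters, so the transform of the product is an average of the
translates of the transform of \<open>g\<close> by at most \<open>a / 2\<close>.\<close>

lemma fourier_transform_times_sinc_eq_0:
  fixes g :: "real \<Rightarrow> complex"
  assumes g: "integrable lborel g" and "a \<ge> 0"
    and supp: "\<And>s. \<bar>s\<bar> \<ge> L \<Longrightarrow> fourier_transform g s = 0"
    and s: "\<bar>s\<bar> \<ge> L + a / 2"
  shows "fourier_transform (\<lambda>x. g x * of_real (sinc (a * pi * x))) s = 0"
proof -
  let ?U = "{-1/2..1/2 :: real}"
  let ?h = "\<lambda>x u. indicator ?U u *\<^sub>R (g x * cis (- 2 * pi * x * (s - a * u)))"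
  have [measurable]: "g \<in> borel_measurable borel" using g by auto
  have ind: "integrable lborel (\<lambda>u. indicator ?U u *\<^sub>R c)" for c :: "'b::{banach, second_countable_topology}"
    by (intro integrable_scaleR_left) simp
  have "integrable (lborel \<Otimes>\<^sub>M lborel) (\<lambda>(x, u). ?h x u)"
  proof (rule lborel_pair.Fubini_integrable)
    have "(\<lambda>x. LINT u|lborel. norm (?h x u)) = (\<lambda>x. norm (g x))"
      by (simp add: norm_mult fun_eq_iff)
    then show "integrable lborel (\<lambda>x. LINT u|lborel. norm (case (x, u) of (x, u) \<Rightarrow> ?h x u))"
      using g by simp
    have "integrable lborel (\<lambda>u. ?h x u)" for x
      by (rule Bochner_Integration.integrable_bound[OF ind[of "g x"]]) (auto simp: norm_mult)
    then show "AE x in lborel. integrable lborel (\<lambda>u. case (x, u) of (x, u) \<Rightarrow> ?h x u)" by simp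
  qed measurable
  then have "(LINT u|lborel. LINT x|lborel. ?h x u) = (LINT x|lborel. LINT u|lborel. ?h x u)"
    by (rule lborel_pair.Fubini_integral)
  also have "(LINT x|lborel. LINT u|lborel. ?h x u) = fourier_transform (\<lambda>x. g x * of_real (sinc (a * pi * x))) s"
    unfolding fourier_transform_real
  proof (rule Bochner_Integration.integral_cong[OF refl])
    fix x
    have "(LINT u|lborel. ?h x u)
       = (LINT u|lborel. (g x * cis (- 2 * pi * x * s)) * (indicator ?U u *\<^sub>R cis (2 * (a * pi * x) * u)))"
      by (intro Bochner_Integration.integral_cong refl) (simp add: cis_mult algebra_simps)
    also have "\<dots> = (g x * cis (- 2 * pi * x * s)) * (LINT u|lborel. indicator ?U u *\<^sub>R cis (2 * (a * pi * x) * u))"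
      by (rule integral_mult_right_zero)
    finally show "(LINT u|lborel. ?h x u) = g x * of_real (sinc (a * pi * x)) * cis (- 2 * pi * x * s)"
      unfolding sinc_eq_integral_cis by (simp only: mult_ac)
  qed
  also have "(LINT u|lborel. LINT x|lborel. ?h x u) = (LINT u|lborel. indicator ?U u *\<^sub>R fourier_transform g (s - a * u))"
    unfolding fourier_transform_real by (intro Bochner_Integration.integral_cong refl integral_scaleR_right)
  also have "\<dots> = 0"
  proof (intro integral_eq_zero_AE AE_I2)
    fix u
    have "\<bar>s - a * u\<bar> \<ge> L" if "u \<in> ?U"
    proof -
      have "\<bar>a * u\<bar> \<le> a * (1 / 2)" unfolding abs_mult using that \<open>a \<ge> 0\<close> by (intro mult_mono) auto
      with s show ?thesis by linarith
    qed
    then show "indicator ?U u *\<^sub>R fourier_transform g (s - a * u) = 0"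
      using supp by (auto simp: indicator_def)
  qed
  finally show ?thesis by simp
qed

text \<open>The factor \<open>sinc(\<pi> \<theta> x)\<^sup>2\<close> of \<open>v\<close> has integral \<open>1 / \<theta>\<close> and transform vanishing outside \<open>(-\<theta>, \<theta>)\<close>. The
remaining factors \<open>sinc(\<pi> b\<^sub>n x)\<^sup>2\<close> are at most one and widen the support by \<open>b\<^sub>n\<close> each, in total by
\<open>1 - \<theta>\<close>. The transform of \<open>v\<close> vanishes also at the end points \<open>-1\<close> and \<open>1\<close>; this matters because
neighbouring points of a unit grid have distance exactly one.\<close>

lemma bandlimited_test_function:
  assumes "0 < \<theta>" "\<theta> < 1"
  obtains \<phi> v where "rapidly_decreasing_entire \<phi>" "\<And>x. \<phi> (of_real x) = of_real (v x)"
    and "\<And>x. v x \<ge> 0" "v 0 = 1" "integrable lborel v" "(LINT x|lborel. v x) \<le> 1 / \<theta>"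
    and "\<And>s. \<bar>s\<bar> \<ge> 1 \<Longrightarrow> fourier_transform (\<lambda>x. complex_of_real (v x)) s = 0"
proof -
  define b :: "nat \<Rightarrow> real" where "b n = (if n = 0 then \<theta> else (1 - \<theta>) * (1 / 2) ^ n)" for n
  have b_pos: "b n > 0" for n using assms by (simp add: b_def)
  have "(\<lambda>n. (1 - \<theta>) * (1 / 2) ^ Suc n) sums ((1 - \<theta>) * 1)"
    by (rule sums_mult[OF power_half_series])
  then have "(\<lambda>n. b (Suc n)) sums (1 - \<theta>)" by (simp add: b_def)
  then have "b sums (1 - \<theta> + b 0)" by (simp only: sums_Suc_iff)
  then have b_sums: "b sums 1" by (simp add: b_def)
  have b_le: "(\<Sum>n<N. b n) \<le> 1" for N
    using sum_le_suminf[of b "{..<N}"] b_sums b_pos by (auto simp: sums_iff less_imp_le)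
  obtain p where p: "rapidly_decreasing_entire p"
    and p_lim: "\<And>z. (\<lambda>N. \<Prod>n<N. complex_sinc (of_real (b n * pi) * z)) \<longlonglongrightarrow> p z"
  proof (rule sinc_product_entire[of "\<lambda>n. b n * pi"])
    show "summable (\<lambda>n. b n * pi)" using b_sums by (intro summable_mult2) (rule sums_summable)
  qed (use b_pos in auto)
  \<comment> \<open>The partial products are real on the line, and their squares converge to \<open>v\<close> dominated by the leading
    factor. So vanishing of the transform passes to the limit.\<close>
  define Q where "Q = (\<lambda>N x. \<Prod>n<N. sinc (b n * pi * x))"
  define v where "v x = (Re (p (of_real x)))\<^sup>2" for x
  have Q: "(\<Prod>n<N. complex_sinc (of_real (b n * pi) * of_real x)) = of_real (Q N x)" for N x
    unfolding Q_def of_real_prod complex_sinc_of_real[symmetric] of_real_mult ..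
  have p_real: "p (of_real x) = of_real (Re (p (of_real x)))"
    and Q_lim: "(\<lambda>N. Q N x) \<longlonglongrightarrow> Re (p (of_real x))" for x
  proof -
    have "(\<lambda>N. complex_of_real (Q N x)) \<longlonglongrightarrow> p (of_real x)"
      using p_lim[of "of_real x"] unfolding Q .
    from tendsto_Re[OF this] tendsto_Im[OF this]
    show "(\<lambda>N. Q N x) \<longlonglongrightarrow> Re (p (of_real x))" "p (of_real x) = of_real (Re (p (of_real x)))"
      by (auto simp: complex_eq_iff LIMSEQ_const_iff)
  qed
  have v_lim: "(\<lambda>N. (Q (Suc N) x)\<^sup>2) \<longlonglongrightarrow> v x" for x
    unfolding v_def by (intro tendsto_power LIMSEQ_Suc Q_lim)
  have sinc_le: "\<bar>sinc x\<bar> \<le> 1" for x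
    using norm_complex_sinc_le[of "of_real x"] unfolding complex_sinc_of_real by simp
  have Q_le: "(Q (Suc N) x)\<^sup>2 \<le> (sinc (b 0 * pi * x))\<^sup>2" for N x
  proof -
    have "\<bar>\<Prod>n<N. sinc (b (Suc n) * pi * x)\<bar> \<le> 1"
      unfolding abs_prod by (rule prod_le_1, rule conjI[OF abs_ge_zero sinc_le])
    then have "(\<Prod>n<N. sinc (b (Suc n) * pi * x))\<^sup>2 \<le> 1"
      by (simp only: abs_square_le_1)
    then show ?thesis
      unfolding Q_def prod.lessThan_Suc_shift power_mult_distrib
      by (rule mult_left_le) simp
  qed
  have v_le: "v x \<le> (sinc (b 0 * pi * x))\<^sup>2" for x
    using Q_le by (intro LIMSEQ_le_const2[OF v_lim]) blast
  have int0: "integrable lborel (\<lambda>x. (sinc (b 0 * pi * x))\<^sup>2)"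
    by (rule integrable_sinc_square) (simp add: b_pos)
  have [measurable]: "Q N \<in> borel_measurable borel" for N
    unfolding Q_def by measurable
  have intQ: "integrable lborel (\<lambda>x. (Q (Suc N) x)\<^sup>2)" for N
    using Q_le by (intro Bochner_Integration.integrable_bound[OF int0]) auto
  have v_meas [measurable]: "v \<in> borel_measurable borel"
    by (rule borel_measurable_LIMSEQ_real[OF v_lim]) measurable
  have int_v: "integrable lborel v"
    using v_le by (intro Bochner_Integration.integrable_bound[OF int0]) (auto simp: v_def)
  have FT0: "fourier_transform (\<lambda>x. of_real ((sinc (b 0 * pi * x))\<^sup>2)) s = of_real (max 0 (1 - \<bar>s / \<theta>\<bar>) / \<theta>)" for s
  proof -
    have "fourier_transform (\<lambda>x. complex_of_real ((sinc (pi * (\<theta> * x)))\<^sup>2)) s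
        = fourier_transform (\<lambda>x. of_real ((sinc (pi * x))\<^sup>2)) (s / \<theta>) / of_real \<theta>"
      using fourier_transform_scale[OF assms(1), of "\<lambda>x. of_real ((sinc (pi * x))\<^sup>2)"] .
    moreover have "b 0 * pi * x = pi * (\<theta> * x)" for x by (simp add: b_def)
    ultimately show ?thesis by (simp only: fourier_transform_sinc_square of_real_divide)
  qed
  have "(LINT x|lborel. v x) \<le> (LINT x|lborel. (sinc (b 0 * pi * x))\<^sup>2)"
    by (intro integral_mono int_v int0 v_le)
  moreover have "complex_of_real (LINT x|lborel. (sinc (b 0 * pi * x))\<^sup>2) = of_real (1 / \<theta>)"
    using FT0[of 0] unfolding fourier_transform_real by (simp del: of_real_power)
  ultimately have V: "(LINT x|lborel. v x) \<le> 1 / \<theta>" by (simp only: of_real_eq_iff)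
  have FTQ: "fourier_transform (\<lambda>x. of_real ((Q (Suc N) x)\<^sup>2)) s = 0" if "\<bar>s\<bar> \<ge> (\<Sum>n<Suc N. b n)" for N s
    using that
  proof (induction N arbitrary: s)
    case 0
    then have "\<bar>s / \<theta>\<bar> \<ge> 1" using assms by (simp add: b_def)
    then show ?case using FT0[of s] by (simp add: Q_def)
  next
    case (Suc N)
    let ?b = "b (Suc N)"
    have sinc_int: "integrable lborel (\<lambda>x. complex_of_real ((Q (Suc N) x)\<^sup>2) * of_real (sinc (?b * pi * x)))"
    proof (rule Bochner_Integration.integrable_bound)
      show "integrable lborel (\<lambda>x. complex_of_real ((Q (Suc N) x)\<^sup>2))"
        by (rule integrable_of_real[OF intQ])
      show "AE x in lborel. norm (complex_of_real ((Q (Suc N) x)\<^sup>2) * of_real (sinc (?b * pi * x)))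
          \<le> norm (complex_of_real ((Q (Suc N) x)\<^sup>2))"
        unfolding norm_mult norm_of_real by (intro AE_I2 mult_left_le sinc_le abs_ge_zero)
    qed auto
    \<comment> \<open>The new factor occurs squared, and each of its two copies widens the support by half of \<open>b (Suc N)\<close>.\<close>
    have "fourier_transform (\<lambda>x. of_real ((Q (Suc N) x)\<^sup>2) * of_real (sinc (?b * pi * x)) * of_real (sinc (?b * pi * x))) s = 0"
    proof (rule fourier_transform_times_sinc_eq_0[OF sinc_int])
      show "fourier_transform (\<lambda>x. of_real ((Q (Suc N) x)\<^sup>2) * of_real (sinc (?b * pi * x))) s = 0"
        if "\<bar>s\<bar> \<ge> (\<Sum>n<Suc N. b n) + ?b / 2" for s
        by (rule fourier_transform_times_sinc_eq_0[OF integrable_of_real[OF intQ] less_imp_le[OF b_pos] Suc.IH that])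
      show "\<bar>s\<bar> \<ge> (\<Sum>n<Suc N. b n) + ?b / 2 + ?b / 2" using Suc.prems by simp
    qed (rule less_imp_le[OF b_pos])
    moreover have "Q (Suc (Suc N)) x = Q (Suc N) x * sinc (?b * pi * x)" for x
      by (simp only: Q_def prod.lessThan_Suc)
    ultimately show ?case by (simp only: power2_eq_square of_real_mult mult_ac)
  qed
  have "fourier_transform (\<lambda>x. complex_of_real (v x)) s = 0" if "\<bar>s\<bar> \<ge> 1" for s
  proof (rule LIMSEQ_unique)
    show "(\<lambda>N. fourier_transform (\<lambda>x. of_real ((Q (Suc N) x)\<^sup>2)) s) \<longlonglongrightarrow> fourier_transform (\<lambda>x. complex_of_real (v x)) s"
      unfolding fourier_transform_real
    proof (rule integral_dominated_convergence)
      show "integrable lborel (\<lambda>x. (sinc (b 0 * pi * x))\<^sup>2)" by (rule int0)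
      show "AE x in lborel. (\<lambda>N. complex_of_real ((Q (Suc N) x)\<^sup>2) * cis (- 2 * pi * x * s))
          \<longlonglongrightarrow> of_real (v x) * cis (- 2 * pi * x * s)"
        by (intro AE_I2 tendsto_mult tendsto_of_real v_lim tendsto_const)
      show "AE x in lborel. norm (complex_of_real ((Q (Suc N) x)\<^sup>2) * cis (- 2 * pi * x * s)) \<le> (sinc (b 0 * pi * x))\<^sup>2" for N
        using Q_le by (intro AE_I2) (simp only: norm_mult norm_of_real norm_cis mult_1_right abs_power2)
    qed measurable
    have "fourier_transform (\<lambda>x. of_real ((Q (Suc N) x)\<^sup>2)) s = 0" for N
      using that b_le[of "Suc N"] by (intro FTQ) linarith
    then show "(\<lambda>N. fourier_transform (\<lambda>x. of_real ((Q (Suc N) x)\<^sup>2)) s) \<longlonglongrightarrow> 0" by simp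
  qed
  moreover have "rapidly_decreasing_entire (\<lambda>z. p z * p z)"
    using p p unfolding rapidly_decreasing_entire_def
  proof (intro conjI allI)
    fix R k
    obtain B C where BC: "\<And>z. \<bar>Im z\<bar> \<le> R \<Longrightarrow> (1 + cmod z) ^ k * cmod (p z) \<le> B"
      "\<And>z. \<bar>Im z\<bar> \<le> R \<Longrightarrow> (1 + cmod z) ^ 0 * cmod (p z) \<le> C"
      using p unfolding rapidly_decreasing_entire_def by metis
    have "(1 + cmod z) ^ k * cmod (p z * p z) \<le> B * C" if "\<bar>Im z\<bar> \<le> R" for z
    proof -
      have "(1 + cmod z) ^ k * cmod (p z) * ((1 + cmod z) ^ 0 * cmod (p z)) \<le> B * C"
        using BC[OF that] by (intro mult_mono) (auto intro: order_trans[rotated])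
      then show ?thesis by (simp add: norm_mult mult_ac)
    qed
    then show "\<exists>B. \<forall>z. \<bar>Im z\<bar> \<le> R \<longrightarrow> (1 + cmod z) ^ k * cmod (p z * p z) \<le> B" by blast
  qed (auto intro!: holomorphic_intros)
  moreover have "p (of_real x) * p (of_real x) = of_real (v x)" for x
    unfolding v_def by (subst (1 2) p_real) (simp add: power2_eq_square)
  moreover have "v 0 = 1"
    using LIMSEQ_unique[OF v_lim[of 0], of 1] by (simp add: Q_def)
  moreover have "v x \<ge> 0" for x by (simp add: v_def)
  ultimately show thesis using int_v V by (intro that)
qed

section \<open>Schwartz functions of several variables with prescribed spectrum\<close>

lemma rapidly_decreasing_entire_holomorphic:
  "rapidly_decreasing_entire \<phi> \<Longrightarrow> \<phi> holomorphic_on S"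
  unfolding rapidly_decreasing_entire_def by (auto intro: holomorphic_on_subset)

text \<open>Cauchy's inequality on the unit circle around \<open>z\<close>, where \<open>1 + \<bar>z\<bar>\<close> is at most \<open>2 (1 + \<bar>w\<bar>)\<close>.\<close>

lemma rapidly_decreasing_entire_deriv:
  assumes \<phi>: "rapidly_decreasing_entire \<phi>"
  shows "rapidly_decreasing_entire (deriv \<phi>)"
  unfolding rapidly_decreasing_entire_def
proof (intro conjI allI)
  show "deriv \<phi> holomorphic_on UNIV"
    by (intro holomorphic_deriv rapidly_decreasing_entire_holomorphic \<phi>) auto
  fix R :: real and k :: nat
  obtain B where B: "\<And>z. \<bar>Im z\<bar> \<le> R + 1 \<Longrightarrow> (1 + cmod z) ^ k * cmod (\<phi> z) \<le> B"
    using \<phi> unfolding rapidly_decreasing_entire_def by metis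
  have "(1 + cmod z) ^ k * cmod (deriv \<phi> z) \<le> 2 ^ k * B" if "\<bar>Im z\<bar> \<le> R" for z
  proof -
    have pos: "0 < (1 + cmod z) ^ k" by (intro zero_less_power) (simp add: add_pos_nonneg)
    have "cmod ((deriv ^^ 1) \<phi> z) \<le> fact 1 * (2 ^ k * B / (1 + cmod z) ^ k) / 1 ^ 1"
    proof (rule Cauchy_inequality)
      fix w assume w: "cmod (z - w) = 1"
      have "cmod z \<le> cmod w + 1" using norm_triangle_sub[of z w] w by simp
      moreover have "0 \<le> cmod w" "0 \<le> cmod z" by simp_all
      ultimately have "1 + cmod z \<le> 2 * (1 + cmod w)" "0 \<le> 1 + cmod z" by argo+
      then have "(1 + cmod z) ^ k \<le> 2 ^ k * (1 + cmod w) ^ k"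
        unfolding power_mult_distrib[symmetric] by (rule power_mono)
      then have "(1 + cmod z) ^ k * cmod (\<phi> w) \<le> 2 ^ k * ((1 + cmod w) ^ k * cmod (\<phi> w))"
        unfolding mult.assoc[symmetric] by (intro mult_right_mono) simp_all
      also have "\<bar>Im w\<bar> \<le> R + 1" using that abs_Im_le_cmod[of "z - w"] w by simp
      then have "2 ^ k * ((1 + cmod w) ^ k * cmod (\<phi> w)) \<le> 2 ^ k * B"
        by (intro mult_left_mono B) auto
      finally show "cmod (\<phi> w) \<le> 2 ^ k * B / (1 + cmod z) ^ k"
        using pos by (simp add: field_simps)
    qed (auto intro!: rapidly_decreasing_entire_holomorphic[OF \<phi>] holomorphic_on_imp_continuous_on)
    then show ?thesis using pos by (simp add: field_simps)
  qed
  then show "\<exists>B. \<forall>z. \<bar>Im z\<bar> \<le> R \<longrightarrow> (1 + cmod z) ^ k * cmod (deriv \<phi> z) \<le> B" by blast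
qed

lemma rapidly_decreasing_entire_modulate:
  assumes \<phi>: "rapidly_decreasing_entire \<phi>"
  shows "rapidly_decreasing_entire (\<lambda>z. \<phi> z * exp (\<i> * of_real c * z))"
  unfolding rapidly_decreasing_entire_def
proof (intro conjI allI)
  show "(\<lambda>z. \<phi> z * exp (\<i> * of_real c * z)) holomorphic_on UNIV"
    by (intro holomorphic_intros rapidly_decreasing_entire_holomorphic \<phi>)
  fix R :: real and k :: nat
  obtain B where B: "\<And>z. \<bar>Im z\<bar> \<le> R \<Longrightarrow> (1 + cmod z) ^ k * cmod (\<phi> z) \<le> B"
    using \<phi> unfolding rapidly_decreasing_entire_def by metis
  have "(1 + cmod z) ^ k * cmod (\<phi> z * exp (\<i> * of_real c * z)) \<le> B * exp (\<bar>c\<bar> * R)" if z: "\<bar>Im z\<bar> \<le> R" for z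
  proof -
    have "- (c * Im z) \<le> \<bar>c\<bar> * \<bar>Im z\<bar>" by (simp flip: abs_mult)
    also have "\<dots> \<le> \<bar>c\<bar> * R" using z by (intro mult_left_mono) auto
    finally have e: "cmod (exp (\<i> * of_real c * z)) \<le> exp (\<bar>c\<bar> * R)" by (simp add: norm_exp_eq_Re)
    have "0 \<le> (1 + cmod z) ^ k * cmod (\<phi> z)" by simp
    then have "0 \<le> B" using B[OF z] by (rule order_trans)
    then show ?thesis unfolding norm_mult mult.assoc[symmetric]
      by (rule mult_mono[OF B[OF z] e _ norm_ge_zero])
  qed
  then show "\<exists>B. \<forall>z. \<bar>Im z\<bar> \<le> R \<longrightarrow> (1 + cmod z) ^ k * cmod (\<phi> z * exp (\<i> * of_real c * z)) \<le> B"
    by blast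
qed

lemma rapidly_decreasing_entire_scale:
  assumes \<phi>: "rapidly_decreasing_entire \<phi>" and "h > 0"
  shows "rapidly_decreasing_entire (\<lambda>z. \<phi> (of_real h * z))"
  unfolding rapidly_decreasing_entire_def
proof (intro conjI allI)
  show "(\<lambda>z. \<phi> (of_real h * z)) holomorphic_on UNIV"
    using holomorphic_on_compose[of "\<lambda>z. of_real h * z" UNIV \<phi>]
      rapidly_decreasing_entire_holomorphic[OF \<phi>]
    by (auto simp: o_def intro!: holomorphic_intros)
  fix R :: real and k :: nat
  obtain B where B: "\<And>z. \<bar>Im z\<bar> \<le> h * R \<Longrightarrow> (1 + cmod z) ^ k * cmod (\<phi> z) \<le> B"
    using \<phi> unfolding rapidly_decreasing_entire_def by metis
  have "(1 + cmod z) ^ k * cmod (\<phi> (of_real h * z)) \<le> (1 + 1 / h) ^ k * B" if z: "\<bar>Im z\<bar> \<le> R" for z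
  proof -
    have "1 + cmod z \<le> (1 + 1 / h) * (1 + h * cmod z)"
      using \<open>h > 0\<close> by (simp add: field_simps add_increasing)
    then have "(1 + cmod z) ^ k \<le> (1 + 1 / h) ^ k * (1 + h * cmod z) ^ k"
      unfolding power_mult_distrib[symmetric] by (rule power_mono) (simp add: add_nonneg_nonneg)
    then have "(1 + cmod z) ^ k * cmod (\<phi> (of_real h * z))
        \<le> (1 + 1 / h) ^ k * ((1 + h * cmod z) ^ k * cmod (\<phi> (of_real h * z)))"
      by (simp add: mult_right_mono flip: mult.assoc)
    also have "\<dots> \<le> (1 + 1 / h) ^ k * B"
      using B[of "of_real h * z"] z \<open>h > 0\<close> by (intro mult_left_mono) (auto simp: norm_mult abs_mult)
    finally show ?thesis .
  qed
  then show "\<exists>B. \<forall>z. \<bar>Im z\<bar> \<le> R \<longrightarrow> (1 + cmod z) ^ k * cmod (\<phi> (of_real h * z)) \<le> B" by blast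
qed

definition tensor :: "('a::euclidean_space \<Rightarrow> complex \<Rightarrow> complex) \<Rightarrow> 'a \<Rightarrow> complex" where
  "tensor \<phi> x = (\<Prod>b\<in>Basis. \<phi> b (of_real (x \<bullet> b)))"

lemma has_derivative_tensor:
  assumes "\<And>b. b \<in> Basis \<Longrightarrow> \<phi> b holomorphic_on UNIV"
  shows "(tensor \<phi> has_derivative (\<lambda>h. \<Sum>b\<in>Basis. deriv (\<phi> b) (of_real (x \<bullet> b)) * of_real (h \<bullet> b) *
            (\<Prod>j\<in>Basis - {b}. \<phi> j (of_real (x \<bullet> j))))) (at x)"
  unfolding tensor_def
proof (rule has_derivative_prod)
  fix b :: 'a assume b: "b \<in> Basis"
  have "(\<phi> b has_derivative (*) (deriv (\<phi> b) (of_real (x \<bullet> b)))) (at (of_real (x \<bullet> b)))"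
    using assms[OF b] holomorphic_derivI[of "\<phi> b" UNIV] by (simp add: has_field_derivative_def)
  moreover have "((\<lambda>x. complex_of_real (x \<bullet> b)) has_derivative (\<lambda>h. of_real (h \<bullet> b))) (at x)"
    by (auto intro!: derivative_eq_intros)
  ultimately show "((\<lambda>x. \<phi> b (of_real (x \<bullet> b))) has_derivative
      (\<lambda>h. deriv (\<phi> b) (of_real (x \<bullet> b)) * of_real (h \<bullet> b))) (at x)"
    using has_derivative_compose by blast
qed

text \<open>A partial derivative changes only one factor of the tensor product. So all iterated partial derivatives
are again tensor products of rapidly decreasing entire functions, and estimates of the products
themselves suffice for membership in the Schwartz space.\<close>

lemma partial_derivative_tensor:
  assumes "\<And>b. b \<in> Basis \<Longrightarrow> \<phi> b holomorphic_on UNIV" and c: "c \<in> Basis"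
  shows "frechet_derivative (tensor \<phi>) (at x) c = tensor (\<phi>(c := deriv (\<phi> c))) x"
proof -
  have "frechet_derivative (tensor \<phi>) (at x) c
     = (\<Sum>b\<in>Basis. deriv (\<phi> b) (of_real (x \<bullet> b)) * of_real (c \<bullet> b) * (\<Prod>j\<in>Basis - {b}. \<phi> j (of_real (x \<bullet> j))))"
    by (subst frechet_derivative_at[OF has_derivative_tensor, symmetric]) (use assms in auto)
  also have "\<dots> = (\<Sum>b\<in>Basis. if b = c then deriv (\<phi> c) (of_real (x \<bullet> c)) * (\<Prod>j\<in>Basis - {c}. \<phi> j (of_real (x \<bullet> j))) else 0)"
    using c by (intro sum.cong) (auto simp: inner_Basis)
  also have "\<dots> = deriv (\<phi> c) (of_real (x \<bullet> c)) * (\<Prod>j\<in>Basis - {c}. \<phi> j (of_real (x \<bullet> j)))"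
    using c by simp
  also have "\<dots> = tensor (\<phi>(c := deriv (\<phi> c))) x"
    unfolding tensor_def by (subst prod.remove[OF finite_Basis c]) (auto intro!: prod.cong)
  finally show ?thesis .
qed

lemma iterated_derivative_tensor:
  assumes "set bs \<subseteq> Basis" "\<And>b. b \<in> Basis \<Longrightarrow> rapidly_decreasing_entire (\<phi> b)"
  shows "\<exists>\<psi>. (\<forall>b\<in>Basis. rapidly_decreasing_entire (\<psi> b)) \<and>
           iterated_derivative bs (tensor \<phi>) = tensor \<psi>"
  using assms(1)
proof (induction bs)
  case Nil
  show ?case using assms(2) by (intro exI[of _ \<phi>]) auto
next
  case (Cons c bs)
  then obtain \<psi> where \<psi>: "\<forall>b\<in>Basis. rapidly_decreasing_entire (\<psi> b)"
    "iterated_derivative bs (tensor \<phi>) = tensor \<psi>" by auto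
  have "iterated_derivative (c # bs) (tensor \<phi>) = tensor (\<psi>(c := deriv (\<psi> c)))"
    unfolding iterated_derivative.simps \<psi>(2) fun_eq_iff
    using \<psi>(1) Cons.prems
    by (auto intro!: partial_derivative_tensor rapidly_decreasing_entire_holomorphic)
  moreover have "\<forall>b\<in>Basis. rapidly_decreasing_entire ((\<psi>(c := deriv (\<psi> c))) b)"
    using \<psi>(1) Cons.prems by (auto intro: rapidly_decreasing_entire_deriv)
  ultimately show ?case by blast
qed

text \<open>The polynomial weight is split over the coordinates by \<open>norm x \<le> \<Sum>\<bar>x\<^sub>b\<bar> \<le> \<Prod>(1 + \<bar>x\<^sub>b\<bar>)\<close>.\<close>

lemma bounded_power_times_tensor:
  fixes \<phi> :: "'a::euclidean_space \<Rightarrow> complex \<Rightarrow> complex"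
  assumes "\<And>b. b \<in> Basis \<Longrightarrow> rapidly_decreasing_entire (\<phi> b)"
  shows "bounded (range (\<lambda>x. norm x ^ k *\<^sub>R tensor \<phi> x))"
proof -
  have "\<exists>B. \<forall>z. \<bar>Im z\<bar> \<le> 0 \<longrightarrow> (1 + cmod z) ^ k * cmod (\<phi> b z) \<le> B" if "b \<in> Basis" for b
    using assms[OF that] unfolding rapidly_decreasing_entire_def by blast
  then obtain B where B: "\<And>b z. b \<in> Basis \<Longrightarrow> \<bar>Im z\<bar> \<le> 0 \<Longrightarrow> (1 + cmod z) ^ k * cmod (\<phi> b z) \<le> B b"
    by metis
  have "norm (norm x ^ k *\<^sub>R tensor \<phi> x) \<le> (\<Prod>b\<in>Basis. B b)" for x :: 'a
  proof -
    have "norm x \<le> (\<Prod>b\<in>Basis. 1 + \<bar>x \<bullet> b\<bar>)"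
      using norm_le_l1[of x] sum_le_prod[of Basis "\<lambda>b. \<bar>x \<bullet> b\<bar>"] by simp
    then have "norm x ^ k \<le> (\<Prod>b\<in>Basis. (1 + \<bar>x \<bullet> b\<bar>) ^ k)"
      unfolding prod_power_distrib[symmetric] by (rule power_mono) simp
    then have "norm (norm x ^ k *\<^sub>R tensor \<phi> x)
        \<le> (\<Prod>b\<in>Basis. (1 + \<bar>x \<bullet> b\<bar>) ^ k) * (\<Prod>b\<in>Basis. cmod (\<phi> b (of_real (x \<bullet> b))))"
      unfolding tensor_def by (simp add: mult_right_mono prod_nonneg flip: prod_norm)
    also have "\<dots> = (\<Prod>b\<in>Basis. (1 + cmod (of_real (x \<bullet> b))) ^ k * cmod (\<phi> b (of_real (x \<bullet> b))))"
      by (simp add: prod.distrib)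
    also have "\<dots> \<le> (\<Prod>b\<in>Basis. B b)"
      using B[of _ "of_real _"] by (intro prod_mono conjI) auto
    finally show ?thesis .
  qed
  then show ?thesis unfolding bounded_iff by blast
qed

lemma tensor_schwartz:
  assumes "\<And>b. b \<in> Basis \<Longrightarrow> rapidly_decreasing_entire (\<phi> b)"
  shows "tensor \<phi> \<in> schwartz"
  unfolding schwartz_def
proof (intro CollectI allI impI)
  fix bs :: "'a list" assume "set bs \<subseteq> Basis"
  then obtain \<psi> where \<psi>: "\<forall>b\<in>Basis. rapidly_decreasing_entire (\<psi> b)"
    "iterated_derivative bs (tensor \<phi>) = tensor \<psi>"
    using iterated_derivative_tensor[of bs \<phi>] assms by blast
  have "tensor \<psi> differentiable_on UNIV"
    unfolding differentiable_on_def differentiable_def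
    using has_derivative_tensor[of \<psi>] \<psi>(1) rapidly_decreasing_entire_holomorphic by blast
  then show "iterated_derivative bs (tensor \<phi>) differentiable_on UNIV \<and>
     (\<forall>k. bounded (range (\<lambda>x. norm x ^ k *\<^sub>R iterated_derivative bs (tensor \<phi>) x)))"
    unfolding \<psi>(2) using bounded_power_times_tensor[of \<psi>] \<psi>(1) by blast
qed

lemma iterated_derivative_sum:
  fixes f :: "'i \<Rightarrow> 'a::euclidean_space \<Rightarrow> complex"
  assumes "\<And>i. i \<in> I \<Longrightarrow> f i \<in> schwartz" "set bs \<subseteq> Basis"
  shows "iterated_derivative bs (\<lambda>x. \<Sum>i\<in>I. f i x) = (\<lambda>x. \<Sum>i\<in>I. iterated_derivative bs (f i) x)"
  using assms(2)
proof (induction bs)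
  case (Cons b bs)
  show ?case
  proof
    fix x :: 'a
    have "((\<lambda>x. \<Sum>i\<in>I. iterated_derivative bs (f i) x) has_derivative
        (\<lambda>h. \<Sum>i\<in>I. frechet_derivative (iterated_derivative bs (f i)) (at x) h)) (at x)"
    proof (rule has_derivative_sum)
      fix i assume "i \<in> I"
      then have "iterated_derivative bs (f i) differentiable at x"
        using assms(1) Cons.prems by (auto simp: schwartz_def differentiable_on_def)
      then show "(iterated_derivative bs (f i) has_derivative
          frechet_derivative (iterated_derivative bs (f i)) (at x)) (at x)"
        by (simp add: frechet_derivative_works)
    qed
    from fun_cong[OF frechet_derivative_at[OF this, symmetric], of b]
    show "iterated_derivative (b # bs) (\<lambda>x. \<Sum>i\<in>I. f i x) x = (\<Sum>i\<in>I. iterated_derivative (b # bs) (f i) x)"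
      using Cons by simp
  qed
qed simp

lemma schwartz_sum:
  fixes f :: "'i \<Rightarrow> 'a::euclidean_space \<Rightarrow> complex"
  assumes I: "finite I" and f: "\<And>i. i \<in> I \<Longrightarrow> f i \<in> schwartz"
  shows "(\<lambda>x. \<Sum>i\<in>I. f i x) \<in> schwartz"
  unfolding schwartz_def
proof (intro CollectI allI impI conjI)
  fix bs :: "'a list" assume bs: "set bs \<subseteq> Basis"
  have eq: "iterated_derivative bs (\<lambda>x. \<Sum>i\<in>I. f i x) = (\<lambda>x. \<Sum>i\<in>I. iterated_derivative bs (f i) x)"
    using f bs by (rule iterated_derivative_sum)
  show "iterated_derivative bs (\<lambda>x. \<Sum>i\<in>I. f i x) differentiable_on UNIV"
    unfolding eq using f I bs by (auto simp: schwartz_def differentiable_on_def intro!: differentiable_sum)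
  fix k
  have "\<exists>B. \<forall>x. norm (norm x ^ k *\<^sub>R iterated_derivative bs (f i) x) \<le> B" if "i \<in> I" for i
    using f[OF that] bs by (auto simp: schwartz_def bounded_iff)
  then obtain B where B: "\<And>i x. i \<in> I \<Longrightarrow> norm (norm x ^ k *\<^sub>R iterated_derivative bs (f i) x) \<le> B i"
    by metis
  then have "norm (norm x ^ k *\<^sub>R (\<Sum>i\<in>I. iterated_derivative bs (f i) x)) \<le> (\<Sum>i\<in>I. B i)" for x
    unfolding scaleR_sum_right by (intro sum_norm_le)
  then show "bounded (range (\<lambda>x. norm x ^ k *\<^sub>R iterated_derivative bs (\<lambda>x. \<Sum>i\<in>I. f i x) x))"
    unfolding eq bounded_iff by blast
qed

lemma
  fixes g :: "'a::euclidean_space \<Rightarrow> real \<Rightarrow> complex"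
  assumes "\<And>b. b \<in> Basis \<Longrightarrow> integrable lborel (g b)"
  shows integrable_product_Basis: "integrable lborel (\<lambda>x. \<Prod>b\<in>Basis. g b (x \<bullet> b))"
    and integral_product_Basis:
      "(LINT x|lborel. (\<Prod>b\<in>Basis. g b (x \<bullet> b))) = (\<Prod>b\<in>Basis. (LINT t|lborel. g b t))"
proof -
  interpret product_sigma_finite "\<lambda>_ :: 'a. lborel :: real measure" by standard
  have [measurable]: "b \<in> Basis \<Longrightarrow> g b \<in> borel_measurable borel" for b
    using assms[of b] by auto
  have m: "(\<lambda>x::'a. \<Prod>b\<in>Basis. g b (x \<bullet> b)) \<in> borel_measurable borel" by measurable
  have eq: "(\<Prod>b\<in>Basis. g b ((\<Sum>b'\<in>Basis. f b' *\<^sub>R b') \<bullet> b)) = (\<Prod>b\<in>Basis. g b (f b))" for f :: "'a \<Rightarrow> real"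
    by (intro prod.cong) simp_all
  show "integrable lborel (\<lambda>x::'a. \<Prod>b\<in>Basis. g b (x \<bullet> b))"
    by (subst lborel_eq, subst integrable_distr_eq)
      (auto simp: m eq intro!: product_integrable_prod assms)
  show "(LINT x|lborel. (\<Prod>b\<in>Basis. g b ((x::'a) \<bullet> b))) = (\<Prod>b\<in>Basis. (LINT t|lborel. g b t))"
    by (subst lborel_eq, subst integral_distr)
      (auto simp: m eq intro!: product_integral_prod assms)
qed

lemma fourier_transform_product_Basis:
  fixes g :: "'a::euclidean_space \<Rightarrow> real \<Rightarrow> complex"
  assumes "\<And>b. b \<in> Basis \<Longrightarrow> integrable lborel (g b)"
  shows "fourier_transform (\<lambda>x. \<Prod>b\<in>Basis. g b (x \<bullet> b)) \<xi> = (\<Prod>b\<in>Basis. fourier_transform (g b) (\<xi> \<bullet> b))"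
proof -
  have "(\<Prod>b\<in>Basis. g b (x \<bullet> b)) * exp (- 2 * of_real pi * \<i> * of_real (x \<bullet> \<xi>))
      = (\<Prod>b\<in>Basis. g b (x \<bullet> b) * cis (- 2 * pi * (x \<bullet> b) * (\<xi> \<bullet> b)))" for x
  proof -
    have "- 2 * of_real pi * \<i> * of_real (x \<bullet> \<xi>) = (\<Sum>b\<in>Basis. \<i> * of_real (- 2 * pi * (x \<bullet> b) * (\<xi> \<bullet> b)))"
      unfolding euclidean_inner[of x \<xi>] by (simp add: sum_distrib_left mult_ac)
    then show ?thesis by (simp add: prod.distrib exp_sum cis_conv_exp)
  qed
  then show ?thesis
    unfolding fourier_transform_real fourier_transform_def[of "\<lambda>x. \<Prod>b\<in>Basis. g b (x \<bullet> b)"]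
    using integral_product_Basis[of "\<lambda>b t. g b t * cis (- 2 * pi * t * (\<xi> \<bullet> b))"] assms
    by (simp add: integrable_times_cis)
qed

lemma fourier_transform_modulate:
  fixes f :: "real \<Rightarrow> complex"
  shows "fourier_transform (\<lambda>x. f x * cis (2 * pi * c * x)) s = fourier_transform f (s - c)"
  unfolding fourier_transform_real by (simp add: cis_mult mult.assoc) (simp add: algebra_simps)

lemma cmod_sum_cis_square:
  assumes "finite J"
  shows "complex_of_real ((cmod (\<Sum>c\<in>J. cis (\<theta> c)))\<^sup>2) = (\<Sum>(c, c')\<in>J \<times> J. cis (\<theta> c - \<theta> c'))"
proof -
  have "complex_of_real ((cmod (\<Sum>c\<in>J. cis (\<theta> c)))\<^sup>2) = (\<Sum>c\<in>J. cis (\<theta> c)) * cnj (\<Sum>c\<in>J. cis (\<theta> c))"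
    by (rule complex_norm_square)
  also have "\<dots> = (\<Sum>c\<in>J. \<Sum>c'\<in>J. cis (\<theta> c - \<theta> c'))"
    by (simp add: sum_product cis_cnj cis_mult)
  finally show ?thesis by (simp add: sum.cartesian_product)
qed

text \<open>\<open>F\<close> is the square of a trigonometric sum over \<open>J\<close>, damped by \<open>\<Prod>\<^sub>b v(h x\<^sub>b)\<close>. Expanding the square gives
a sum over pairs \<open>(c, c')\<close> of tensor products of modulated copies of \<open>v\<close>; the transform of each summand
is the transform of \<open>\<Prod>\<^sub>b v(h x\<^sub>b)\<close> translated by \<open>c - c'\<close>, which vanishes unless all coordinates of
\<open>\<xi> - (c - c')\<close> are smaller than \<open>h\<close>. At \<open>\<xi> = 0\<close> the separation of \<open>J\<close> leaves only the pairs with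
\<open>c = c'\<close>.\<close>

lemma grid_test_function:
  fixes J :: "'a::euclidean_space set"
  assumes J: "finite J" and "0 < \<theta>" "\<theta> < 1" and h: "h > 0"
    and sep: "\<And>c c'. c \<in> J \<Longrightarrow> c' \<in> J \<Longrightarrow> c \<noteq> c' \<Longrightarrow> \<exists>b\<in>Basis. h \<le> \<bar>(c - c') \<bullet> b\<bar>"
  obtains F :: "'a \<Rightarrow> real" where "(\<lambda>x. complex_of_real (F x)) \<in> schwartz"
    and "continuous_on UNIV F" "\<forall>x. F x \<ge> 0" "integrable lborel F"
    and "F 0 = (real (card J))\<^sup>2"
    and "(LINT x|lborel. F x) \<le> real (card J) * (1 / (\<theta> * h)) ^ DIM('a)"
    and "\<forall>\<xi>. fourier_transform (\<lambda>x. complex_of_real (F x)) \<xi> \<noteq> 0 \<longrightarrow>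
           (\<exists>c\<in>J. \<exists>c'\<in>J. \<forall>b\<in>Basis. \<bar>(\<xi> - (c - c')) \<bullet> b\<bar> < h)"
proof -
  obtain \<phi> v where \<phi>: "rapidly_decreasing_entire \<phi>" "\<And>x. \<phi> (of_real x) = of_real (v x)"
    and v: "\<And>x. v x \<ge> 0" "v 0 = 1" "integrable lborel v" "(LINT x|lborel. v x) \<le> 1 / \<theta>"
    and FTv: "\<And>s. \<bar>s\<bar> \<ge> 1 \<Longrightarrow> fourier_transform (\<lambda>x. complex_of_real (v x)) s = 0"
    using bandlimited_test_function[OF assms(2,3)] by blast
  define F where "F x = (\<Prod>b\<in>Basis. v (h * (x \<bullet> b))) * (cmod (\<Sum>c\<in>J. cis (2 * pi * (c \<bullet> x))))\<^sup>2" for x :: 'a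
  define \<Phi> where "\<Phi> = (\<lambda>(c :: 'a, c' :: 'a) (b :: 'a) z. \<phi> (of_real h * z) * exp (\<i> * of_real (2 * pi * ((c - c') \<bullet> b)) * z))"
  define g where "g = (\<lambda>(c :: 'a, c' :: 'a) (b :: 'a) t. complex_of_real (v (h * t)) * cis (2 * pi * ((c - c') \<bullet> b) * t))"
  have vh: "integrable lborel (\<lambda>t. v (h * t))"
    using v(3) h lborel_integrable_real_affine_iff[of h v 0] by simp
  have g_int: "integrable lborel (g cc b)" for cc b
    unfolding g_def by (cases cc) (auto intro!: integrable_times_cis integrable_of_real vh)
  have FTg: "fourier_transform (g (c, c') b) s = fourier_transform (\<lambda>x. of_real (v x)) ((s - (c - c') \<bullet> b) / h) / of_real h"
    for c c' b s
    unfolding g_def prod.case fourier_transform_modulate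
    using fourier_transform_scale[OF h, of "\<lambda>x. of_real (v x)"] by simp
  have tensor: "tensor (\<Phi> cc) x = (\<Prod>b\<in>Basis. g cc b (x \<bullet> b))" for cc x
  proof -
    have "\<Phi> cc b (of_real t) = g cc b t" for b t
      using \<phi>(2)[of "h * t"] by (cases cc) (simp add: \<Phi>_def g_def cis_conv_exp mult_ac)
    then show ?thesis by (simp add: tensor_def)
  qed
  have F_eq: "complex_of_real (F x) = (\<Sum>cc\<in>J\<times>J. tensor (\<Phi> cc) x)" for x
  proof -
    have "tensor (\<Phi> (c, c')) x = of_real (\<Prod>b\<in>Basis. v (h * (x \<bullet> b))) * cis (2 * pi * (c \<bullet> x) - 2 * pi * (c' \<bullet> x))" for c c'
    proof -
      have "2 * pi * (c \<bullet> x) - 2 * pi * (c' \<bullet> x) = (\<Sum>b\<in>Basis. 2 * pi * ((c - c') \<bullet> b) * (x \<bullet> b))"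
        unfolding right_diff_distrib[symmetric] inner_diff_left[symmetric] euclidean_inner[of "c - c'" x]
        by (simp add: sum_distrib_left mult_ac)
      then show ?thesis
        unfolding tensor g_def by (simp add: prod.distrib cis_conv_exp exp_sum sum_distrib_left)
    qed
    then have "(\<Sum>cc\<in>J\<times>J. tensor (\<Phi> cc) x)
       = of_real (\<Prod>b\<in>Basis. v (h * (x \<bullet> b))) * (\<Sum>(c, c')\<in>J\<times>J. cis (2 * pi * (c \<bullet> x) - 2 * pi * (c' \<bullet> x)))"
      unfolding sum_distrib_left by (intro sum.cong) auto
    then show ?thesis unfolding F_def of_real_mult cmod_sum_cis_square[OF J] by simp
  qed
  have schwartz: "(\<lambda>x. complex_of_real (F x)) \<in> schwartz"
    unfolding F_eq
  proof (intro schwartz_sum tensor_schwartz)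
    fix cc :: "'a \<times> 'a" and b
    show "rapidly_decreasing_entire (\<Phi> cc b)"
      unfolding \<Phi>_def by (cases cc)
        (simp only: prod.case, intro rapidly_decreasing_entire_modulate rapidly_decreasing_entire_scale \<phi> h)
  qed (use J in auto)
  then have "iterated_derivative [] (\<lambda>x. complex_of_real (F x)) differentiable_on UNIV"
    unfolding schwartz_def by (metis (mono_tags, lifting) empty_subsetI list.set(1) mem_Collect_eq)
  then have "continuous_on UNIV (\<lambda>x. complex_of_real (F x))"
    by (intro differentiable_imp_continuous_on) simp
  from continuous_on_Re[OF this] have cont: "continuous_on UNIV F" by simp
  have tensor_int: "integrable lborel (tensor (\<Phi> cc))" for cc
    unfolding tensor by (intro integrable_product_Basis g_int)
  then have "integrable lborel (\<lambda>x. complex_of_real (F x))" unfolding F_eq by simp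
  then have F_int: "integrable lborel F" using integrable_Re by force
  have FT: "fourier_transform (\<lambda>x. complex_of_real (F x)) \<xi>
      = (\<Sum>(c, c')\<in>J\<times>J. \<Prod>b\<in>Basis. fourier_transform (\<lambda>x. of_real (v x)) ((\<xi> - (c - c')) \<bullet> b / h) / of_real h)" for \<xi>
  proof -
    have e: "exp (- 2 * complex_of_real pi * \<i> * of_real (x \<bullet> \<xi>)) = cis (- 2 * pi * (x \<bullet> \<xi>))" for x
      by (simp add: cis_conv_exp mult_ac)
    have "fourier_transform (\<lambda>x. complex_of_real (F x)) \<xi> = (\<Sum>cc\<in>J\<times>J. fourier_transform (tensor (\<Phi> cc)) \<xi>)"
      unfolding fourier_transform_def F_eq sum_distrib_right e
      by (intro Bochner_Integration.integral_sum integrable_times_cis tensor_int) auto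
    also have "\<dots> = (\<Sum>cc\<in>J\<times>J. \<Prod>b\<in>Basis. fourier_transform (g cc b) (\<xi> \<bullet> b))"
      unfolding tensor by (intro sum.cong refl fourier_transform_product_Basis g_int)
    also have "\<dots> = (\<Sum>(c, c')\<in>J\<times>J. \<Prod>b\<in>Basis. fourier_transform (\<lambda>x. of_real (v x)) ((\<xi> - (c - c')) \<bullet> b / h) / of_real h)"
      by (intro sum.cong) (auto simp: FTg inner_diff_left)
    finally show ?thesis .
  qed
  have spectrum: "\<exists>c\<in>J. \<exists>c'\<in>J. \<forall>b\<in>Basis. \<bar>(\<xi> - (c - c')) \<bullet> b\<bar> < h"
    if nz: "fourier_transform (\<lambda>x. complex_of_real (F x)) \<xi> \<noteq> 0" for \<xi>
  proof -
    obtain c c' where c: "c \<in> J" "c' \<in> J"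
      and ne: "(\<Prod>b\<in>Basis. fourier_transform (\<lambda>x. complex_of_real (v x)) ((\<xi> - (c - c')) \<bullet> b / h) / of_real h) \<noteq> 0"
      using nz unfolding FT by (auto elim!: sum.not_neutral_contains_not_neutral simp del: prod_zero_iff)
    have "\<bar>(\<xi> - (c - c')) \<bullet> b\<bar> < h" if "b \<in> Basis" for b
    proof (rule ccontr)
      assume "\<not> ?thesis"
      then have "\<bar>(\<xi> - (c - c')) \<bullet> b / h\<bar> \<ge> 1" using h by simp
      from FTv[OF this] ne that show False by auto
    qed
    with c show ?thesis by blast
  qed
  define V where "V = (LINT x|lborel. v x)"
  have V: "0 \<le> V" "V \<le> 1 / \<theta>" using v by (simp_all add: V_def)
  have FT0: "fourier_transform (\<lambda>x. complex_of_real (v x)) 0 = of_real V"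
    unfolding fourier_transform_real V_def by simp
  have diag: "(\<Prod>b\<in>Basis. fourier_transform (\<lambda>x. complex_of_real (v x)) ((0 - (c - c')) \<bullet> b / h) / of_real h)
      = (if c = c' then of_real ((V / h) ^ DIM('a)) else 0)" if cJ: "c \<in> J" "c' \<in> J" for c c' :: 'a
  proof (cases "c = c'")
    case False
    then obtain b where b: "b \<in> Basis" "h \<le> \<bar>(c - c') \<bullet> b\<bar>" using sep cJ by blast
    then have "\<bar>(0 - (c - c')) \<bullet> b / h\<bar> \<ge> 1" using h by (simp add: inner_diff_left)
    from FTv[OF this] b(1) False show ?thesis by (auto intro!: prod_zero)
  qed (simp add: FT0)
  have "complex_of_real (LINT x|lborel. F x) = fourier_transform (\<lambda>x. complex_of_real (F x)) 0"
    by (simp add: fourier_transform_def)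
  also have "\<dots> = (\<Sum>c\<in>J. \<Sum>c'\<in>J. if c = c' then of_real ((V / h) ^ DIM('a)) else 0)"
    unfolding FT sum.cartesian_product[symmetric] by (intro sum.cong refl diag)
  also have "\<dots> = of_real (real (card J) * (V / h) ^ DIM('a))"
    using J by simp
  finally have "(LINT x|lborel. F x) = real (card J) * (V / h) ^ DIM('a)"
    by (simp only: of_real_eq_iff)
  also have "\<dots> \<le> real (card J) * (1 / (\<theta> * h)) ^ DIM('a)"
    using V h assms(2) by (intro mult_left_mono power_mono) (auto simp: field_simps)
  finally have "(LINT x|lborel. F x) \<le> real (card J) * (1 / (\<theta> * h)) ^ DIM('a)" .
  moreover have "F 0 = (real (card J))\<^sup>2" by (simp add: F_def v)
  moreover have "F x \<ge> 0" for x unfolding F_def using v by (simp add: prod_nonneg)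
  ultimately show thesis using schwartz cont F_int spectrum by (intro that[of F] allI impI)
qed

section \<open>Linear statistics of a point process\<close>

lemma counting_measure_simps [simp]:
  "sets (counting_measure P) = sets borel" "space (counting_measure P) = UNIV"
  by (simp_all add: counting_measure_def)

lemma nn_integral_counting_measure:
  fixes f :: "'a::euclidean_space \<Rightarrow> ennreal"
  assumes "f \<in> borel_measurable borel"
  shows "(\<integral>\<^sup>+x. f x \<partial>counting_measure P) = (\<integral>\<^sup>+x. f x \<partial>count_space P)"
  unfolding counting_measure_def using assms by (subst nn_integral_distr) auto

lemma integrable_counting_measure:
  assumes "locally_finite_set P" "f \<in> compactly_supported_continuous"
  shows "integrable (counting_measure P) f"
proof -
  have [measurable]: "f \<in> borel_measurable borel"
    using assms(2) by (auto simp: compactly_supported_continuous_def intro: borel_measurable_continuous_onI)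
  have "finite (P \<inter> closure {x. f x \<noteq> 0})"
    using assms by (auto simp: locally_finite_set_def compactly_supported_continuous_def)
  then have "finite {p\<in>P. f p \<noteq> 0}"
    by (rule rev_finite_subset) (auto intro: closure_subset[THEN subsetD])
  then have "integrable (count_space P) f"
    by (simp add: integrable_iff_bounded nn_integral_count_space)
  then show ?thesis unfolding counting_measure_def by (subst integrable_distr_eq) auto
qed

lemma integrable_lborel_compactly_supported:
  fixes f :: "'a::euclidean_space \<Rightarrow> real"
  assumes "f \<in> compactly_supported_continuous"
  shows "integrable lborel f"
proof -
  let ?S = "closure {x. f x \<noteq> 0}"
  have "continuous_on ?S f" "compact ?S"
    using assms by (auto simp: compactly_supported_continuous_def intro: continuous_on_subset)
  then have "integrable lborel (\<lambda>x. indicator ?S x *\<^sub>R f x)"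
    by (intro borel_integrable_compact)
  also have "(\<lambda>x. indicator ?S x *\<^sub>R f x) = f"
    using closure_subset[of "{x. f x \<noteq> 0}"] by (auto simp: fun_eq_iff indicator_def)
  finally show ?thesis .
qed

lemma
  assumes "point_process \<eta>"
  shows space_point_process: "space \<eta> = configurations"
    and measurable_integral_point_process:
      "f \<in> compactly_supported_continuous \<Longrightarrow> (\<lambda>\<omega>. LINT x|\<omega>. f x) \<in> borel_measurable \<eta>"
proof -
  have "U \<subseteq> configurations" if "openin vague_topology U" for U :: "'a measure set"
    using openin_subset[OF that] unfolding vague_topology_def topology_generated_by_topspace by auto
  then have sub: "{U. openin vague_topology U} \<subseteq> Pow (configurations :: 'a measure set)"
    by auto
  have eq: "sets \<eta> = sigma_sets configurations {U. openin vague_topology U}"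
    using assms sub by (simp add: point_process_def vague_borel_def)
  have "space \<eta> = space (vague_borel :: 'a measure measure)"
    using assms by (intro sets_eq_imp_space_eq) (simp add: point_process_def)
  then show sp: "space \<eta> = configurations"
    using sub by (simp add: vague_borel_def space_measure_of)
  assume f: "f \<in> compactly_supported_continuous"
  show "(\<lambda>\<omega>. LINT x|\<omega>. f x) \<in> borel_measurable \<eta>"
  proof (rule borel_measurableI)
    fix U :: "real set" assume "open U"
    then have "openin vague_topology {\<omega> \<in> configurations. (LINT x|\<omega>. f x) \<in> U}"
      unfolding vague_topology_def using f by (intro topology_generated_by_Basis) auto
    then have "{\<omega> \<in> configurations. (LINT x|\<omega>. f x) \<in> U} \<in> sets \<eta>"
      unfolding eq by (intro sigma_sets.Basic) auto
    then show "(\<lambda>\<omega>. LINT x|\<omega>. f x) -` U \<inter> space \<eta> \<in> sets \<eta>"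
      by (simp add: sp vimage_def Int_def conj_commute)
  qed
qed

text \<open>The hypotheses on a point process concern compactly supported continuous functions. The increasing
cutoffs \<open>max 0 (min 1 (n - norm x))\<close> transfer them to all nonnegative continuous functions by monotone
convergence.\<close>

lemma cutoff_compactly_supported:
  assumes "continuous_on UNIV f"
  shows "(\<lambda>x. f x * max 0 (min 1 (r - norm x))) \<in> compactly_supported_continuous"
proof -
  have "{x. f x * max 0 (min 1 (r - norm x)) \<noteq> 0} \<subseteq> cball 0 r" by (auto simp: max_def min_def split: if_splits)
  then have "closure {x. f x * max 0 (min 1 (r - norm x)) \<noteq> 0} \<subseteq> cball 0 r"
    by (rule closure_minimal) simp
  then have "compact (closure {x. f x * max 0 (min 1 (r - norm x)) \<noteq> 0})"
    by (meson closed_closure compact_cball compact_eq_bounded_closed bounded_subset)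
  then show ?thesis unfolding compactly_supported_continuous_def
    using assms by (auto intro!: continuous_intros)
qed

lemma SUP_cutoff:
  fixes x :: "'a::real_normed_vector"
  assumes "c \<ge> 0"
  shows "(SUP n. ennreal (c * max 0 (min 1 (real n - norm x)))) = ennreal c"
proof (rule antisym)
  obtain n where "real n \<ge> norm x + 1" using real_arch_simple by blast
  then have "ennreal c = ennreal (c * max 0 (min 1 (real n - norm x)))" by simp
  also have "\<dots> \<le> (SUP n. ennreal (c * max 0 (min 1 (real n - norm x))))"
    by (rule SUP_upper) simp
  finally show "ennreal c \<le> (SUP n. ennreal (c * max 0 (min 1 (real n - norm x))))" .
qed (intro SUP_least ennreal_leI mult_left_le, use assms in auto)

lemma incseq_cutoff:
  assumes "\<And>x. f x \<ge> 0"
  shows "incseq (\<lambda>n x. ennreal (f x * max 0 (min 1 (real n - norm x))))"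
  by (intro monoI le_funI ennreal_leI mult_left_mono assms) auto

lemma nn_integral_SUP_cutoff:
  fixes f :: "'a::euclidean_space \<Rightarrow> real"
  assumes "continuous_on UNIV f" "\<And>x. f x \<ge> 0" "sets M = sets borel"
  shows "(\<integral>\<^sup>+x. ennreal (f x) \<partial>M) = (SUP n. \<integral>\<^sup>+x. ennreal (f x * max 0 (min 1 (real n - norm x))) \<partial>M)"
proof -
  have [measurable]: "f \<in> borel_measurable borel"
    using assms by (intro borel_measurable_continuous_onI)
  show ?thesis
    by (subst nn_integral_monotone_convergence_SUP[symmetric])
      (auto intro!: incseq_cutoff assms simp: SUP_cutoff assms measurable_cong_sets[OF assms(3) refl])
qed

lemma
  fixes f :: "'a::euclidean_space \<Rightarrow> real"
  assumes pp: "point_process \<eta>" and int: "has_intensity \<eta> \<rho>" and \<rho>: "\<rho> \<ge> 0"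
    and f: "continuous_on UNIV f" "\<And>x. f x \<ge> 0"
  shows measurable_nn_integral_point_process: "(\<lambda>\<omega>. \<integral>\<^sup>+x. f x \<partial>\<omega>) \<in> borel_measurable \<eta>"
    and campbell_formula: "(\<integral>\<^sup>+\<omega>. (\<integral>\<^sup>+x. f x \<partial>\<omega>) \<partial>\<eta>) = ennreal \<rho> * (\<integral>\<^sup>+x. f x \<partial>lborel)"
proof -
  let ?f = "\<lambda>n x. f x * max 0 (min 1 (real n - norm x))"
  note sp = space_point_process[OF pp]
  have cs: "?f n \<in> compactly_supported_continuous" for n by (rule cutoff_compactly_supported[OF f(1)])
  have eq: "(\<integral>\<^sup>+x. f x \<partial>\<omega>) = (SUP n. ennreal (LINT x|\<omega>. ?f n x))" if \<omega>: "\<omega> \<in> space \<eta>" for \<omega>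
  proof -
    obtain P where P: "locally_finite_set P" "\<omega> = counting_measure P"
      using \<omega> unfolding sp by (auto simp: configurations_def)
    have "(\<integral>\<^sup>+x. ?f n x \<partial>\<omega>) = ennreal (LINT x|\<omega>. ?f n x)" for n
      using integrable_counting_measure[OF P(1) cs[of n]] unfolding P(2)
      by (intro nn_integral_eq_integral) (auto simp: f)
    then show ?thesis using nn_integral_SUP_cutoff[OF f, of \<omega>] P(2) by simp
  qed
  have m[measurable]: "(\<lambda>\<omega>. LINT x|\<omega>. ?f n x) \<in> borel_measurable \<eta>" for n
    by (rule measurable_integral_point_process[OF pp cs])
  have "(\<lambda>\<omega>. SUP n. ennreal (LINT x|\<omega>. ?f n x)) \<in> borel_measurable \<eta>" by measurable
  then show "(\<lambda>\<omega>. \<integral>\<^sup>+x. f x \<partial>\<omega>) \<in> borel_measurable \<eta>"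
    using eq by (simp cong: measurable_cong)
  have nonneg: "0 \<le> (LINT x|M. ?f n x)" for n and M :: "'a measure"
    by (intro Bochner_Integration.integral_nonneg) (auto simp: f)
  have intl: "integrable lborel (?f n)" for n
    by (rule integrable_lborel_compactly_supported[OF cs])
  have "(\<integral>\<^sup>+\<omega>. (\<integral>\<^sup>+x. f x \<partial>\<omega>) \<partial>\<eta>) = (\<integral>\<^sup>+\<omega>. (SUP n. ennreal (LINT x|\<omega>. ?f n x)) \<partial>\<eta>)"
    using eq by (intro nn_integral_cong) auto
  also have "\<dots> = (SUP n. \<integral>\<^sup>+\<omega>. ennreal (LINT x|\<omega>. ?f n x) \<partial>\<eta>)"
  proof (rule nn_integral_monotone_convergence_SUP_AE)
    show "AE \<omega> in \<eta>. ennreal (LINT x|\<omega>. ?f n x) \<le> ennreal (LINT x|\<omega>. ?f (Suc n) x)" for n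
    proof (rule AE_I2)
      fix \<omega> assume "\<omega> \<in> space \<eta>"
      then obtain P where P: "locally_finite_set P" "\<omega> = counting_measure P"
        unfolding sp by (auto simp: configurations_def)
      show "ennreal (LINT x|\<omega>. ?f n x) \<le> ennreal (LINT x|\<omega>. ?f (Suc n) x)"
        unfolding P(2) by (intro ennreal_leI Bochner_Integration.integral_mono
            integrable_counting_measure[OF P(1)] cs mult_left_mono f) auto
    qed
  qed auto
  also have "\<dots> = (SUP n. ennreal \<rho> * (\<integral>\<^sup>+x. ?f n x \<partial>lborel))"
  proof (rule SUP_cong[OF refl])
    fix n
    have "(\<integral>\<^sup>+\<omega>. ennreal (LINT x|\<omega>. ?f n x) \<partial>\<eta>) = ennreal (\<rho> * (LINT x|lborel. ?f n x))"
      using int cs[of n] nonneg unfolding has_intensity_def by (subst nn_integral_eq_integral) auto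
    also have "\<dots> = ennreal \<rho> * (\<integral>\<^sup>+x. ?f n x \<partial>lborel)"
      using intl[of n] nonneg \<rho> by (subst nn_integral_eq_integral) (auto simp: f ennreal_mult)
    finally show "(\<integral>\<^sup>+\<omega>. ennreal (LINT x|\<omega>. ?f n x) \<partial>\<eta>) = ennreal \<rho> * (\<integral>\<^sup>+x. ?f n x \<partial>lborel)" .
  qed
  also have "\<dots> = ennreal \<rho> * (\<integral>\<^sup>+x. f x \<partial>lborel)"
    by (subst nn_integral_SUP_cutoff[OF f sets_lborel]) (rule SUP_mult_left_ennreal[symmetric])
  finally show "(\<integral>\<^sup>+\<omega>. (\<integral>\<^sup>+x. f x \<partial>\<omega>) \<partial>\<eta>) = ennreal \<rho> * (\<integral>\<^sup>+x. f x \<partial>lborel)" .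
qed

text \<open>Otherwise almost no configuration meets the ball of radius \<open>\<delta>\<close>, and the statistic of a bump supported
there would have mean zero instead of \<open>\<rho>\<close> times the positive integral of the bump.\<close>

lemma charges_neighbourhood_of_origin:
  fixes \<eta> :: "'a::euclidean_space measure measure"
  assumes pp: "point_process \<eta>" and int: "has_intensity \<eta> \<rho>" and "\<rho> > 0" "\<delta> > 0"
    and all: "AE \<omega> in \<eta>. Q \<omega>"
  obtains P p where "locally_finite_set P" "Q (counting_measure P)" "p \<in> P" "norm p < \<delta>"
proof (rule ccontr)
  assume no: "\<not> thesis"
  let ?g = "\<lambda>x :: 'a. max 0 (\<delta> - norm x)"
  have g: "continuous_on UNIV ?g" "\<And>x. ?g x \<ge> 0" by (auto intro!: continuous_intros)
  have [measurable]: "?g \<in> borel_measurable borel" by measurable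
  have "AE \<omega> in \<eta>. (\<integral>\<^sup>+x. ?g x \<partial>\<omega>) = 0"
    using all
  proof (rule AE_mp, intro AE_I2 impI)
    fix \<omega> assume "\<omega> \<in> space \<eta>" and Q: "Q \<omega>"
    then obtain P where P: "locally_finite_set P" "\<omega> = counting_measure P"
      unfolding space_point_process[OF pp] by (auto simp: configurations_def)
    with Q no that have "norm p \<ge> \<delta>" if "p \<in> P" for p
      using that by (meson not_le)
    then have "(\<integral>\<^sup>+x. ?g x \<partial>count_space P) = (\<integral>\<^sup>+x. 0 \<partial>count_space P)"
      by (intro nn_integral_cong) (simp add: max_absorb1)
    then show "(\<integral>\<^sup>+x. ?g x \<partial>\<omega>) = 0"
      unfolding P(2) by (subst nn_integral_counting_measure) auto
  qed
  then have "(\<integral>\<^sup>+\<omega>. (\<integral>\<^sup>+x. ?g x \<partial>\<omega>) \<partial>\<eta>) = 0"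
    by (simp cong: nn_integral_cong_AE)
  then have "(\<integral>\<^sup>+x. ?g x \<partial>lborel) = 0"
    using campbell_formula[OF pp int _ g] \<open>\<rho> > 0\<close> by (simp add: ennreal_zero_less_mult_iff)
  then have "AE x in lborel. ?g x \<le> 0"
    by (subst (asm) nn_integral_0_iff_AE) (auto simp: ennreal_eq_0_iff)
  then have "emeasure lborel {x. \<not> ?g x \<le> 0} = 0"
    by (subst (asm) AE_iff_measurable[OF _ refl]) auto
  also have "{x. \<not> ?g x \<le> 0} = ball (0::'a) \<delta>" by (auto simp: max_def)
  finally show False using \<open>\<delta> > 0\<close> content_ball_pos[of \<delta> "0::'a"] by (simp add: measure_def)
qed

text \<open>The variance of the linear statistic \<open>N\<close> of \<open>f\<close> vanishes, so \<open>N\<close> is almost surely equal to its mean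
\<open>m = \<rho> \<integral>f\<close>. If \<open>f 0 > m\<close>, then \<open>f > m\<close> on a ball around the origin. With positive probability the
configuration has a point in that ball, and there \<open>N > m\<close> because \<open>f\<close> is nonnegative.\<close>

lemma value_at_origin_le_intensity_times_integral:
  fixes f :: "'a::euclidean_space \<Rightarrow> real"
  assumes pp: "point_process \<eta>" and int: "has_intensity \<eta> \<rho>" and "\<rho> > 0"
    and spec: "is_bartlett_spectrum \<eta> \<sigma>"
    and "open \<Omega>" and null: "emeasure \<sigma> \<Omega> = 0"
    and schwartz: "(\<lambda>x. complex_of_real (f x)) \<in> schwartz"
    and f: "continuous_on UNIV f" "\<And>x. f x \<ge> 0" "integrable lborel f"
    and spectrum: "\<And>\<xi>. \<xi> \<notin> \<Omega> \<Longrightarrow> fourier_transform (\<lambda>x. complex_of_real (f x)) \<xi> = 0"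
  shows "f 0 \<le> \<rho> * (LINT x|lborel. f x)"
proof (rule ccontr)
  define m where "m = \<rho> * (LINT x|lborel. f x)"
  have "m \<ge> 0" unfolding m_def using \<open>\<rho> > 0\<close> f by simp
  assume "\<not> f 0 \<le> \<rho> * (LINT x|lborel. f x)"
  then have "m < f 0" by (simp add: m_def)
  define N where "N = (\<lambda>\<omega>. \<integral>\<^sup>+x. f x \<partial>\<omega>)"
  have [measurable]: "f \<in> borel_measurable borel"
    using f by (intro borel_measurable_continuous_onI)
  have [measurable]: "N \<in> borel_measurable \<eta>"
    unfolding N_def using \<open>\<rho> > 0\<close> by (intro measurable_nn_integral_point_process[OF pp int] f) auto
  have "(\<integral>\<^sup>+\<omega>. N \<omega> \<partial>\<eta>) = ennreal \<rho> * (\<integral>\<^sup>+x. f x \<partial>lborel)"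
    unfolding N_def using \<open>\<rho> > 0\<close> by (intro campbell_formula[OF pp int] f) auto
  also have "\<dots> = ennreal m"
    using f \<open>\<rho> > 0\<close> by (subst nn_integral_eq_integral) (auto simp: m_def ennreal_mult)
  finally have EN: "(\<integral>\<^sup>+\<omega>. N \<omega> \<partial>\<eta>) = ennreal m" .
  have fin: "AE \<omega> in \<eta>. N \<omega> \<noteq> \<infinity>"
    by (rule nn_integral_noteq_infinite) (auto simp: EN)
  \<comment> \<open>This identity holds even where \<open>N \<omega> = \<infinity>\<close>: both sides are then zero by convention.\<close>
  have stat: "linear_statistic (\<lambda>x. complex_of_real (f x)) \<omega> = complex_of_real (enn2real (N \<omega>))"
    if \<omega>: "\<omega> \<in> space \<eta>" for \<omega>
  proof -
    obtain P where "\<omega> = counting_measure P"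
      using \<omega> unfolding space_point_process[OF pp] by (auto simp: configurations_def)
    then have "sets \<omega> = sets borel" by simp
    then have "f \<in> borel_measurable \<omega>" by (simp cong: measurable_cong_sets)
    then show ?thesis
      unfolding linear_statistic_def N_def integral_complex_of_real
      by (subst integral_eq_nn_integral) (auto simp: f)
  qed
  have "(LINT \<omega>|\<eta>. enn2real (N \<omega>)) = enn2real (\<integral>\<^sup>+\<omega>. ennreal (enn2real (N \<omega>)) \<partial>\<eta>)"
    by (rule integral_eq_nn_integral) auto
  also have "(\<integral>\<^sup>+\<omega>. ennreal (enn2real (N \<omega>)) \<partial>\<eta>) = (\<integral>\<^sup>+\<omega>. N \<omega> \<partial>\<eta>)"
    using fin by (intro nn_integral_cong_AE) (auto simp: top.not_eq_extremum)
  finally have "(LINT \<omega>|\<eta>. enn2real (N \<omega>)) = m" using EN \<open>m \<ge> 0\<close> by simp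
  then have mean: "(LINT \<omega>|\<eta>. linear_statistic (\<lambda>x. complex_of_real (f x)) \<omega>) = complex_of_real m"
    by (simp add: stat integral_complex_of_real cong: Bochner_Integration.integral_cong)
  have "complex_variance \<eta> (linear_statistic (\<lambda>x. complex_of_real (f x)))
     = (\<integral>\<^sup>+\<xi>. ennreal ((cmod (fourier_transform (\<lambda>x. complex_of_real (f x)) \<xi>))\<^sup>2) \<partial>\<sigma>)"
    using spec schwartz by (simp add: is_bartlett_spectrum_def)
  also have "\<dots> = (\<integral>\<^sup>+\<xi>. 0 \<partial>\<sigma>)"
  proof (rule nn_integral_cong_AE)
    have "\<Omega> \<in> sets \<sigma>" using spec \<open>open \<Omega>\<close> by (simp add: is_bartlett_spectrum_def)
    then have "AE \<xi> in \<sigma>. \<xi> \<notin> \<Omega>" using null by (intro AE_not_in) auto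
    then show "AE \<xi> in \<sigma>. ennreal ((cmod (fourier_transform (\<lambda>x. complex_of_real (f x)) \<xi>))\<^sup>2) = 0"
      by (rule eventually_mono) (simp add: spectrum)
  qed
  finally have "(\<integral>\<^sup>+\<omega>. ennreal ((cmod (linear_statistic (\<lambda>x. complex_of_real (f x)) \<omega> - complex_of_real m))\<^sup>2) \<partial>\<eta>) = 0"
    unfolding complex_variance_def mean by simp
  then have "(\<integral>\<^sup>+\<omega>. ennreal ((enn2real (N \<omega>) - m)\<^sup>2) \<partial>\<eta>) = 0"
    by (simp add: stat flip: of_real_diff cong: nn_integral_cong)
  then have "AE \<omega> in \<eta>. ennreal ((enn2real (N \<omega>) - m)\<^sup>2) = 0"
    by (subst (asm) nn_integral_0_iff_AE) auto
  with fin have N: "AE \<omega> in \<eta>. N \<omega> = ennreal m"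
    by eventually_elim (auto simp: ennreal_eq_0_iff top.not_eq_extremum)
  have "open {x. m < f x}" using f(1) by (intro open_Collect_less continuous_intros)
  with \<open>m < f 0\<close> obtain \<delta> where \<delta>: "\<delta> > 0" "\<And>x. norm x < \<delta> \<Longrightarrow> m < f x"
    by (auto simp: open_contains_ball subset_eq)
  obtain P p where P: "locally_finite_set P" "N (counting_measure P) = ennreal m" "p \<in> P" "norm p < \<delta>"
    using charges_neighbourhood_of_origin[OF pp int \<open>\<rho> > 0\<close> \<delta>(1) N] by metis
  have "ennreal (f p) \<le> (\<integral>\<^sup>+x. ennreal (f x) \<partial>count_space P)"
    using P(3) by (rule nn_integral_ge_point)
  also have "\<dots> = N (counting_measure P)"
    unfolding N_def by (subst nn_integral_counting_measure) auto
  finally have "f p \<le> m" using P(2) \<open>m \<ge> 0\<close> by (simp add: ennreal_le_iff)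
  with \<delta>(2)[OF P(4)] show False by simp
qed

section \<open>Grids and the packing bound\<close>

definition grid_floor :: "real \<Rightarrow> 'a::euclidean_space \<Rightarrow> 'a" where
  "grid_floor h x = (\<Sum>b\<in>Basis. (h * of_int \<lfloor>(x \<bullet> b) / h\<rfloor>) *\<^sub>R b)"

lemma inner_grid_floor: "b \<in> Basis \<Longrightarrow> grid_floor h x \<bullet> b = h * of_int \<lfloor>(x \<bullet> b) / h\<rfloor>"
  by (simp add: grid_floor_def)

lemma grid_floor_bounds:
  assumes "h > 0" "b \<in> Basis"
  shows "grid_floor h x \<bullet> b \<le> x \<bullet> b" "x \<bullet> b < grid_floor h x \<bullet> b + h"
proof -
  define m where "m = \<lfloor>(x \<bullet> b) / h\<rfloor>"
  have "of_int m \<le> (x \<bullet> b) / h" "(x \<bullet> b) / h < of_int m + 1" unfolding m_def by linarith+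
  then show "grid_floor h x \<bullet> b \<le> x \<bullet> b" "x \<bullet> b < grid_floor h x \<bullet> b + h"
    using assms by (simp_all add: inner_grid_floor field_simps flip: m_def)
qed

lemma grid_floor_separated:
  assumes "h > 0" "grid_floor h x \<noteq> grid_floor h y"
  shows "\<exists>b\<in>Basis. h \<le> \<bar>(grid_floor h x - grid_floor h y) \<bullet> b\<bar>"
proof -
  obtain b where b: "b \<in> Basis" "grid_floor h x \<bullet> b \<noteq> grid_floor h y \<bullet> b"
    using assms(2) by (metis euclidean_eqI)
  define n where "n = \<lfloor>(x \<bullet> b) / h\<rfloor> - \<lfloor>(y \<bullet> b) / h\<rfloor>"
  have "n \<noteq> 0" using b by (auto simp: n_def inner_grid_floor)
  then have "1 \<le> \<bar>real_of_int n\<bar>" by linarith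
  then have "h * 1 \<le> h * \<bar>real_of_int n\<bar>" using assms(1) by (intro mult_left_mono) auto
  also have "\<dots> = \<bar>(grid_floor h x - grid_floor h y) \<bullet> b\<bar>"
    using assms(1) b by (simp add: n_def inner_diff_left inner_grid_floor abs_mult flip: right_diff_distrib)
  finally show ?thesis using b(1) by auto
qed

lemma finite_grid_floor_image:
  fixes K :: "'a::euclidean_space set"
  assumes "bounded K" "h > 0"
  shows "finite (grid_floor h ` K)"
proof -
  obtain R where R: "\<And>x. x \<in> K \<Longrightarrow> norm x \<le> R" using assms(1) bounded_iff by blast
  define l u where "l = \<lfloor>(- R) / h\<rfloor>" and "u = \<lfloor>R / h\<rfloor>"
  let ?n = "\<lambda>x. \<lambda>b\<in>Basis. \<lfloor>(x \<bullet> b) / h\<rfloor>"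
  have "?n ` K \<subseteq> Basis \<rightarrow>\<^sub>E {l..u}"
  proof clarify
    fix x assume "x \<in> K"
    have "\<lfloor>(x \<bullet> b) / h\<rfloor> \<in> {l..u}" if "b \<in> Basis" for b
    proof -
      have "- R \<le> x \<bullet> b" "x \<bullet> b \<le> R"
        using Basis_le_norm[OF that, of x] R[OF \<open>x \<in> K\<close>] by linarith+
      then show ?thesis
        unfolding l_def u_def atLeastAtMost_iff
        using assms(2) by (intro conjI floor_mono divide_right_mono) auto
    qed
    then show "?n x \<in> Basis \<rightarrow>\<^sub>E {l..u}"
      by auto
  qed
  then have "finite (?n ` K)"
    by (rule finite_subset) (intro finite_PiE, auto)
  then have "finite ((\<lambda>m. \<Sum>b\<in>Basis. (h * of_int (m b)) *\<^sub>R b) ` ?n ` K)"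
    by (rule finite_imageI)
  also have "(\<lambda>m. \<Sum>b\<in>Basis. (h * of_int (m b)) *\<^sub>R b) ` ?n ` K = grid_floor h ` K"
    unfolding image_image by (intro image_cong refl) (simp add: grid_floor_def)
  finally show ?thesis .
qed

lemma emeasure_le_card_grid:
  fixes K :: "'a::euclidean_space set"
  assumes "bounded K" "h > 0"
  shows "emeasure lebesgue K \<le> ennreal (real (card (grid_floor h ` K)) * h ^ DIM('a))"
proof -
  let ?J = "grid_floor h ` K"
  let ?Q = "\<lambda>c::'a. cbox c (c + h *\<^sub>R One)"
  have fin: "finite ?J" by (rule finite_grid_floor_image[OF assms])
  have Q: "emeasure lebesgue (?Q c) = ennreal (h ^ DIM('a))" for c
    using assms(2) by (simp add: emeasure_lborel_cbox_eq inner_add_left)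
  have "K \<subseteq> (\<Union>c\<in>?J. ?Q c)"
  proof
    fix x assume "x \<in> K"
    moreover have "x \<in> ?Q (grid_floor h x)"
      using grid_floor_bounds[OF assms(2), of _ x] by (auto simp: mem_box inner_add_left less_imp_le)
    ultimately show "x \<in> (\<Union>c\<in>?J. ?Q c)" by blast
  qed
  then have "emeasure lebesgue K \<le> emeasure lebesgue (\<Union>c\<in>?J. ?Q c)"
    using fin by (intro emeasure_mono sets.finite_UN) auto
  also have "\<dots> \<le> (\<Sum>c\<in>?J. emeasure lebesgue (?Q c))"
    using fin by (intro emeasure_subadditive_finite) auto
  also have "\<dots> = ennreal (real (card ?J) * h ^ DIM('a))"
    unfolding Q using assms(2) by (simp add: ennreal_mult ennreal_of_nat_eq_real_of_nat)
  finally show ?thesis .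
qed

text \<open>By compactness an \<open>e\<close>-neighbourhood of \<open>K - K\<close> lies in \<open>\<Omega>\<close>. The mesh \<open>h\<close> is chosen so small that
the spectrum of the test function attached to the grid points below \<open>K\<close> lies in this neighbourhood.
The test function inequality then bounds the total volume of the grid cubes that cover \<open>K\<close>.\<close>

lemma emeasure_compact_le_intensity:
  fixes \<eta> :: "'a::euclidean_space measure measure"
  assumes pp: "point_process \<eta>" and int: "has_intensity \<eta> \<rho>" and "\<rho> > 0"
    and spec: "is_bartlett_spectrum \<eta> \<sigma>"
    and "open \<Omega>" and null: "emeasure \<sigma> \<Omega> = 0"
    and K: "compact K" "{x - y | x y. x \<in> K \<and> y \<in> K} \<subseteq> \<Omega>"
  shows "emeasure lebesgue K \<le> ennreal \<rho>"
proof -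
  have cpt: "compact {x - y | x y. x \<in> K \<and> y \<in> K}" using K(1) by (rule compact_differences[OF _ K(1)])
  obtain e where e: "e > 0" "(\<Union>z\<in>{x - y | x y. x \<in> K \<and> y \<in> K}. ball z e) \<subseteq> \<Omega>"
    by (rule compact_subset_open_imp_ball_epsilon_subset[OF cpt \<open>open \<Omega>\<close> K(2)])
  define h where "h = e / (2 * real DIM('a))"
  have h: "h > 0" using e(1) by (simp add: h_def)
  let ?J = "grid_floor h ` K"
  have fin: "finite ?J" using finite_grid_floor_image[OF compact_imp_bounded[OF K(1)] h] .
  have \<theta>_bound: "real (card ?J) * h ^ DIM('a) * \<theta> ^ DIM('a) \<le> \<rho>" if \<theta>: "0 < \<theta>" "\<theta> < 1" for \<theta>
  proof (cases "?J = {}")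
    case False
    then have card: "0 < real (card ?J)" using fin by (simp add: card_gt_0_iff)
    have sep: "\<exists>b\<in>Basis. h \<le> \<bar>(c - c') \<bullet> b\<bar>" if "c \<in> ?J" "c' \<in> ?J" "c \<noteq> c'" for c c'
      using that grid_floor_separated[OF h] by blast
    obtain F :: "'a \<Rightarrow> real" where F: "(\<lambda>x. complex_of_real (F x)) \<in> schwartz"
      "continuous_on UNIV F" "\<forall>x. F x \<ge> 0" "integrable lborel F"
      and F0: "F 0 = (real (card ?J))\<^sup>2"
      and FI: "(LINT x|lborel. F x) \<le> real (card ?J) * (1 / (\<theta> * h)) ^ DIM('a)"
      and FT: "\<forall>\<xi>. fourier_transform (\<lambda>x. complex_of_real (F x)) \<xi> \<noteq> 0 \<longrightarrow>
           (\<exists>c\<in>?J. \<exists>c'\<in>?J. \<forall>b\<in>Basis. \<bar>(\<xi> - (c - c')) \<bullet> b\<bar> < h)"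
      by (rule grid_test_function[OF fin \<theta> h], erule (2) sep, rule that)
    have spectrum: "\<xi> \<in> \<Omega>" if ne: "fourier_transform (\<lambda>x. complex_of_real (F x)) \<xi> \<noteq> 0" for \<xi>
    proof -
      obtain c c' where c: "c \<in> ?J" "c' \<in> ?J" "\<forall>b\<in>Basis. \<bar>(\<xi> - (c - c')) \<bullet> b\<bar> < h"
        using FT[rule_format, OF ne] by (elim bexE)
      obtain x where x: "x \<in> K" "c = grid_floor h x" using c(1) by (rule imageE)
      obtain y where y: "y \<in> K" "c' = grid_floor h y" using c(2) by (rule imageE)
      have close: "\<bar>(\<xi> - (grid_floor h x - grid_floor h y)) \<bullet> b\<bar> < h" if "b \<in> Basis" for b
        using c(3) that unfolding x(2) y(2) by (rule bspec)
      \<comment> \<open>Rounding \<open>x\<close> and \<open>y\<close> down to the grid changes each coordinate of \<open>x - y\<close> by less than \<open>h\<close>, because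
        the two errors have the same sign before subtraction.\<close>
      have "\<bar>(\<xi> - (x - y)) \<bullet> b\<bar> < 2 * h" if b: "b \<in> Basis" for b
        using close[OF b] grid_floor_bounds[OF h b, of x] grid_floor_bounds[OF h b, of y]
        by (simp add: inner_diff_left abs_less_iff)
      then have "(\<Sum>b\<in>Basis. \<bar>(\<xi> - (x - y)) \<bullet> b\<bar>) < (\<Sum>b\<in>(Basis::'a set). 2 * h)"
        by (intro sum_strict_mono) auto
      also have "\<dots> = e" by (simp add: h_def)
      finally have "dist (x - y) \<xi> < e"
        using norm_le_l1[of "\<xi> - (x - y)"] by (simp add: dist_norm norm_minus_commute)
      then have "\<xi> \<in> (\<Union>z\<in>{x - y | x y. x \<in> K \<and> y \<in> K}. ball z e)" using x(1) y(1) by auto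
      then show ?thesis using e(2) by blast
    qed
    have "(real (card ?J))\<^sup>2 \<le> \<rho> * (LINT x|lborel. F x)"
      unfolding F0[symmetric] using spectrum
      by (intro value_at_origin_le_intensity_times_integral[OF pp int \<open>\<rho> > 0\<close> spec \<open>open \<Omega>\<close> null F(1,2) F(3)[rule_format] F(4)]) blast
    also have "\<dots> \<le> \<rho> * (real (card ?J) * (1 / (\<theta> * h)) ^ DIM('a))"
      using FI \<open>\<rho> > 0\<close> by (intro mult_left_mono) auto
    finally have "real (card ?J) * real (card ?J) \<le> real (card ?J) * (\<rho> * (1 / (\<theta> * h)) ^ DIM('a))"
      by (simp only: power2_eq_square mult_ac)
    then have "real (card ?J) \<le> \<rho> * (1 / (\<theta> * h)) ^ DIM('a)"
      using card by (simp only: mult_le_cancel_left_pos)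
    then show ?thesis
      using \<theta>(1) h by (simp add: power_divide power_mult_distrib field_simps)
  qed (use \<open>\<rho> > 0\<close> in simp)
  have "((\<lambda>\<theta>. real (card ?J) * h ^ DIM('a) * \<theta> ^ DIM('a)) \<longlongrightarrow> real (card ?J) * h ^ DIM('a) * 1 ^ DIM('a)) (at_left 1)"
    by (intro tendsto_intros)
  moreover have "\<forall>\<^sub>F \<theta> in at_left 1. real (card ?J) * h ^ DIM('a) * \<theta> ^ DIM('a) \<le> \<rho>"
    by (rule eventually_mono[OF eventually_at_left_real[OF zero_less_one]]) (use \<theta>_bound in auto)
  ultimately have "real (card ?J) * h ^ DIM('a) * 1 ^ DIM('a) \<le> \<rho>"
    by (rule tendsto_upperbound) simp
  then have "ennreal (real (card ?J) * h ^ DIM('a)) \<le> ennreal \<rho>" by (intro ennreal_leI) simp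
  with emeasure_le_card_grid[OF compact_imp_bounded[OF K(1)] h] show ?thesis by (rule order_trans)
qed

text \<open>With \<open>S = C/2\<close>, symmetry and convexity give \<open>S - S \<subseteq> C\<close>. The interior of \<open>S\<close> is an increasing union of
compact sets, and the frontier of a convex set is negligible, so these compact sets exhaust the measure
of \<open>S\<close>, also when \<open>C\<close> is unbounded.\<close>

lemma emeasure_symmetric_convex_le_packing_bound:
  fixes C \<Omega> :: "'a::euclidean_space set"
  assumes "C \<subseteq> \<Omega>" and sym: "\<And>x. x \<in> C \<Longrightarrow> - x \<in> C" and C: "convex C"
  shows "ennreal (1 / 2 ^ DIM('a)) * emeasure lebesgue C \<le> packing_bound \<Omega>"
proof -
  define S where "S = (\<lambda>x. (1/2) *\<^sub>R x + 0) ` C"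
  have "convex S" unfolding S_def using C by (simp add: convex_scaling)
  then have null: "frontier S \<in> null_sets lebesgue"
    using negligible_convex_frontier negligible_iff_null_sets by blast
  obtain K where K: "\<And>n. compact (K n)" "\<And>n. K n \<subseteq> interior S" "\<And>n. K n \<subseteq> interior (K (Suc n))"
    "(\<Union>n. K n) = interior S"
    using open_Union_compact_subsets[OF open_interior[of S]] by metis
  have "emeasure lebesgue (K n) \<le> packing_bound \<Omega>" for n
  proof -
    have "x - y \<in> \<Omega>" if "x \<in> K n" "y \<in> K n" for x y
    proof -
      have "x \<in> S" "y \<in> S" using that K(2) interior_subset by blast+
      then obtain u w where "u \<in> C" "x = (1/2) *\<^sub>R u" "w \<in> C" "y = (1/2) *\<^sub>R w"
        by (auto simp: S_def)
      then have "x - y = (1/2) *\<^sub>R u + (1/2) *\<^sub>R (- w)" by simp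
      also have "\<dots> \<in> C" using C sym \<open>u \<in> C\<close> \<open>w \<in> C\<close> by (intro convexD) auto
      finally show ?thesis using \<open>C \<subseteq> \<Omega>\<close> by blast
    qed
    then show ?thesis unfolding packing_bound_def using K(1) by (intro SUP_upper) auto
  qed
  then have "(SUP n. emeasure lebesgue (K n)) \<le> packing_bound \<Omega>" by (intro SUP_least)
  also have "(SUP n. emeasure lebesgue (K n)) = emeasure lebesgue (\<Union>n. K n)"
    using K(1) subset_trans[OF K(3) interior_subset]
    by (intro SUP_emeasure_incseq incseq_SucI) (auto simp: compact_imp_closed)
  finally have "emeasure lebesgue (interior S) \<le> packing_bound \<Omega>" unfolding K(4) .
  moreover have "emeasure lebesgue S \<le> emeasure lebesgue (interior S \<union> frontier S)"
    using closure_subset[of S] null by (intro emeasure_mono) (auto simp: frontier_def)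
  moreover have "emeasure lebesgue (interior S \<union> frontier S) = emeasure lebesgue (interior S)"
    using null by (intro emeasure_Un_null_set) auto
  moreover have "emeasure lebesgue S = ennreal (1 / 2 ^ DIM('a)) * emeasure lebesgue C"
    unfolding S_def emeasure_lebesgue_affine by (simp add: power_divide)
  ultimately show ?thesis by simp
qed

theorem theorem1p4:
  fixes \<Omega> :: "(real ^ 'd) set"
    and \<eta> :: "(real ^ 'd) measure measure"
    and \<sigma> :: "(real ^ 'd) measure"
    and \<rho> :: real
  assumes "open \<Omega>" and "0 \<in> \<Omega>"
    and "point_process \<eta>"
    and "translation_invariant \<eta>"
    and "has_intensity \<eta> \<rho>" and "\<rho> > 0"
    and "uniformly_separated \<eta>"
    and "is_bartlett_spectrum \<eta> \<sigma>"
    and "emeasure \<sigma> \<Omega> = 0"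
  shows "packing_bound \<Omega> \<le> ennreal \<rho> \<and>
    (\<forall>C. C \<subseteq> \<Omega> \<and> (\<forall>x\<in>C. - x \<in> C) \<and> convex C \<longrightarrow>
       ennreal (1 / 2 ^ CARD('d)) * emeasure lebesgue C \<le> ennreal \<rho>)"
proof -
  have bound: "packing_bound \<Omega> \<le> ennreal \<rho>"
    unfolding packing_bound_def
    using emeasure_compact_le_intensity[OF assms(3,5,6,8,1,9)] by (intro SUP_least) auto
  moreover have "ennreal (1 / 2 ^ CARD('d)) * emeasure lebesgue C \<le> ennreal \<rho>"
    if "C \<subseteq> \<Omega>" "\<forall>x\<in>C. - x \<in> C" "convex C" for C
    using emeasure_symmetric_convex_le_packing_bound[of C \<Omega>] that bound by (auto intro: order_trans)
  ultimately show ?thesis by blast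
qed

end
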